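(* Let $A$ be a finite abstract simplicial complex that has a simplicial idempotent Taylor polymorphism. Then every connected component of $A$ is contractible.
   Context: An (abstract) simplicial complex is a set $A$ together with a collection of finite subsets of $A$, called faces, which contains the empty set and all singletons and is closed under taking subsets; it is finite if $A$ is finite. A simplicial map is a map of vertex sets sending faces to faces. The power $A^n$ is the complex on the vertex set $A^n$ in which a finite set is a face iff each of its $n$ coordinate projections is a face of $A$. A (simplicial) polymorphism of $A$ of arity $n$ is a simplicial map $f\colon A^n\to A$; it is idempotent if $f(x,\dots,x)=x$ for all $x\in A$. A polymorphism $f$ of arity $n>1$ is a Taylor polymorphism if for every $1\le m\le n$ there are $a_1,\dots,a_n,b_1,\dots,b_n\in\{x,y\}$ (symbols for two variables) with $a_m=x$ and $b_m=y$ such that $f(a_1,\dots,a_n)=f(b_1,\dots,b_n)$ holds for all $x,y\in A$. Connected components and contractibility refer to the geometric realization. *)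

theory Defs
  imports "HOL-Analysis.Analysis"
begin

record 'a scomplex =
  verts :: "'a set"
  faces :: "'a set set"

definition abstract_simplicial_complex :: "'a scomplex \<Rightarrow> bool" where
  "abstract_simplicial_complex A \<longleftrightarrow>
     (\<forall>\<sigma>\<in>faces A. finite \<sigma> \<and> \<sigma> \<subseteq> verts A) \<and>
     {} \<in> faces A \<and>
     (\<forall>v\<in>verts A. {v} \<in> faces A) \<and>
     (\<forall>\<sigma>\<in>faces A. \<forall>\<tau>\<subseteq>\<sigma>. \<tau> \<in> faces A)"

definition simplicial_map :: "'a scomplex \<Rightarrow> 'b scomplex \<Rightarrow> ('a \<Rightarrow> 'b) \<Rightarrow> bool" where
  "simplicial_map A B f \<longleftrightarrow>
     f \<in> verts A \<rightarrow> verts B \<and> (\<forall>\<sigma>\<in>faces A. f ` \<sigma> \<in> faces B)"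

text \<open>An n-tuple is an extensional function on the index set {1..n}.\<close>

definition power_complex :: "'a scomplex \<Rightarrow> nat \<Rightarrow> (nat \<Rightarrow> 'a) scomplex" where
  "power_complex A n =
     \<lparr>verts = {1..n} \<rightarrow>\<^sub>E verts A,
      faces = {\<sigma>. finite \<sigma> \<and> \<sigma> \<subseteq> {1..n} \<rightarrow>\<^sub>E verts A \<and>
                  (\<forall>i\<in>{1..n}. (\<lambda>x. x i) ` \<sigma> \<in> faces A)}\<rparr>"

lemma abstract_simplicial_complex_power:
  assumes "abstract_simplicial_complex A"
  shows "abstract_simplicial_complex (power_complex A n)"
  unfolding abstract_simplicial_complex_def power_complex_def scomplex.simps
proof (intro conjI ballI allI impI)
  fix \<sigma> \<tau>
  assume s: "\<sigma> \<in> {\<sigma>. finite \<sigma> \<and> \<sigma> \<subseteq> {1..n} \<rightarrow>\<^sub>E verts A \<and>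
                  (\<forall>i\<in>{1..n}. (\<lambda>x. x i) ` \<sigma> \<in> faces A)}" and t: "\<tau> \<subseteq> \<sigma>"
  have "(\<lambda>x. x i) ` \<tau> \<in> faces A" if "i \<in> {1..n}" for i
    using assms s image_mono[OF t, of "\<lambda>x. x i"] that
    unfolding abstract_simplicial_complex_def by blast
  with s t show "\<tau> \<in> {\<sigma>. finite \<sigma> \<and> \<sigma> \<subseteq> {1..n} \<rightarrow>\<^sub>E verts A \<and>
                  (\<forall>i\<in>{1..n}. (\<lambda>x. x i) ` \<sigma> \<in> faces A)}"
    by (auto intro: finite_subset)
qed (use assms in \<open>auto simp: abstract_simplicial_complex_def PiE_iff\<close>)

definition polymorphism :: "'a scomplex \<Rightarrow> nat \<Rightarrow> ((nat \<Rightarrow> 'a) \<Rightarrow> 'a) \<Rightarrow> bool" where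
  "polymorphism A n f \<longleftrightarrow> simplicial_map (power_complex A n) A f"

definition idempotent_op :: "'a scomplex \<Rightarrow> nat \<Rightarrow> ((nat \<Rightarrow> 'a) \<Rightarrow> 'a) \<Rightarrow> bool" where
  "idempotent_op A n f \<longleftrightarrow> (\<forall>x\<in>verts A. f (\<lambda>i\<in>{1..n}. x) = x)"

datatype var_symbol = VarX | VarY

text \<open>The choice of symbols may depend on m, but not on the values x, y of the variables.\<close>

definition taylor_polymorphism :: "'a scomplex \<Rightarrow> nat \<Rightarrow> ((nat \<Rightarrow> 'a) \<Rightarrow> 'a) \<Rightarrow> bool" where
  "taylor_polymorphism A n f \<longleftrightarrow>
     polymorphism A n f \<and> n > 1 \<and>
     (\<forall>m\<in>{1..n}. \<exists>a b. a m = VarX \<and> b m = VarY \<and>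
        (\<forall>x\<in>verts A. \<forall>y\<in>verts A.
           f (\<lambda>i\<in>{1..n}. case a i of VarX \<Rightarrow> x | VarY \<Rightarrow> y) =
           f (\<lambda>i\<in>{1..n}. case b i of VarX \<Rightarrow> x | VarY \<Rightarrow> y)))"

text \<open>The points of the realization are given by their barycentric coordinates. The topology is that
  of a subspace of the product of copies of the real line indexed by the vertices; for a
  finite complex this is the usual (weak) topology, for an infinite one it need not be.\<close>

definition geometric_realization :: "'a scomplex \<Rightarrow> ('a \<Rightarrow> real) topology" where
  "geometric_realization A =
     subtopology (powertop_real (verts A))
       {t. (\<forall>v\<in>verts A. 0 \<le> t v) \<and>
           {v\<in>verts A. t v \<noteq> 0} \<in> faces A \<and>
           (\<Sum>v\<in>{v\<in>verts A. t v \<noteq> 0}. t v) = 1}"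

end

theory Submission imports Defs begin

text \<open>
  Induct on the number of vertices. For connected \<open>A\<close>, every idempotent non-injective simplicial self-map
  is a retraction onto a smaller induced subcomplex that again has an idempotent Taylor polymorphism, so it
  is nullhomotopic, and hence every non-injective simplicial self-map has a nullhomotopic power. Fixing all
  but one group of arguments of \<open>f\<close> at a base vertex gives self-maps that are either automorphisms or
  non-injective. If two disjoint groups of arguments give automorphisms, a binary polymorphism of \<open>A\<close> is a
  quasigroup operation and \<open>A\<close> is a simplex. Otherwise the Taylor identities yield a binary
  polymorphism \<open>g\<close> whose diagonal is injective but whose translations at the base vertex are not.
  Substituting \<open>g\<close> into itself makes both translations nullhomotopic, while \<open>g\<close> stays idempotent. The multilinear
  extension of such a \<open>g\<close> is, up to homotopy, a map that is constant on the two axes and the identity on the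
  diagonal. Nesting it over maps homotopic to the identity, each of which collapses one member of a
  finite closed cover to the base vertex, contracts the realization.
\<close>

section \<open>Maps that are nullhomotopic on the axes\<close>

text \<open>A non-injective self-map has a nullhomotopic power, an automorphism has a power equal to
  the identity, so the two kinds can be homotopic only if the realization is contractible.
  Translations at different vertices are homotopic, which is why only one base vertex has to be
  examined. The obstacle is the non-injective case: iterating an operation in one argument replaces
  one translation by a power, but alters the other one without control unless that one is already
  nullhomotopic. So one side is settled by a minimality argument in a family whose diagonals are
  merely injective, and the other by iteration after idempotence has been restored. All
  nullhomotopies obtained are free, whereas the final contraction needs a map that is strictly
  constant on the axes; collapsing a neighbourhood of the base vertex makes room to correct
  them.\<close>

abbreviation homotopic_maps :: "'a topology \<Rightarrow> 'b topology \<Rightarrow> ('a \<Rightarrow> 'b) \<Rightarrow> ('a \<Rightarrow> 'b) \<Rightarrow> bool" where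
  "homotopic_maps \<equiv> homotopic_with (\<lambda>_. True)"

abbreviation nullhomotopic :: "'a topology \<Rightarrow> 'b topology \<Rightarrow> ('a \<Rightarrow> 'b) \<Rightarrow> bool" where
  "nullhomotopic X Y f \<equiv> \<exists>c. homotopic_maps X Y f (\<lambda>_. c)"

lemma homotopic_maps_cong:
  assumes "homotopic_maps X Y f g"
    and "\<And>x. x \<in> topspace X \<Longrightarrow> f' x = f x" "\<And>x. x \<in> topspace X \<Longrightarrow> g' x = g x"
  shows "homotopic_maps X Y f' g'"
  by (rule homotopic_with_eq[OF assms]) auto

lemma homotopic_maps_in_topspace:
  assumes "homotopic_maps X Y f g" "x \<in> topspace X"
  shows "f x \<in> topspace Y"
  using homotopic_with_imp_continuous_maps[OF assms(1)] assms(2)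
  by (auto simp: continuous_map_def)

lemma homotopic_maps_pair:
  assumes "homotopic_maps X Y f f'" "homotopic_maps X Z g g'"
  shows "homotopic_maps X (prod_topology Y Z) (\<lambda>x. (f x, g x)) (\<lambda>x. (f' x, g' x))"
proof -
  have "homotopic_maps (prod_topology X X) (prod_topology Y Z)
          (\<lambda>z. (f (fst z), g (snd z))) (\<lambda>z. (f' (fst z), g' (snd z)))"
    by (rule homotopic_with_prod_topology[OF assms]) simp
  from homotopic_with_compose_continuous_map_right[OF this, of X "\<lambda>x. (x, x)"]
  show ?thesis
    by (simp add: o_def continuous_map_paired)
qed

lemma continuous_map_homotopy:
  assumes H: "continuous_map (prod_topology (top_of_set {0..1::real}) X) Z H"
    and a: "continuous_map Y euclideanreal a" "\<And>y. y \<in> topspace Y \<Longrightarrow> 0 \<le> a y \<and> a y \<le> 1"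
    and b: "continuous_map Y X b"
  shows "continuous_map Y Z (\<lambda>y. H (a y, b y))"
proof -
  have "continuous_map Y (top_of_set {0..1}) a"
    using a by (auto intro: continuous_map_into_subtopology)
  then have "continuous_map Y (prod_topology (top_of_set {0..1}) X) (\<lambda>y. (a y, b y))"
    using b by (simp add: continuous_map_paired)
  from continuous_map_compose[OF this H] show ?thesis by (simp add: o_def)
qed

lemma homotopic_withI:
  assumes "continuous_map (prod_topology (top_of_set {0..1::real}) X) Y h"
    and "\<And>x. x \<in> topspace X \<Longrightarrow> h (0, x) = f x" "\<And>x. x \<in> topspace X \<Longrightarrow> h (1, x) = g x"
    and "\<And>t. 0 \<le> t \<Longrightarrow> t \<le> 1 \<Longrightarrow> P (\<lambda>x. h (t, x))"
    and "\<And>h k. (\<And>x. x \<in> topspace X \<Longrightarrow> h x = k x) \<Longrightarrow> P h \<longleftrightarrow> P k"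
  shows "homotopic_with P X Y f g"
proof -
  have "\<exists>h. continuous_map (prod_topology (top_of_set {0..1::real}) X) Y h \<and>
      (\<forall>x\<in>topspace X. h (0, x) = f x) \<and> (\<forall>x\<in>topspace X. h (1, x) = g x) \<and>
      (\<forall>t\<in>{0..1}. P (\<lambda>x. h (t, x)))"
    using assms(1-4) by (intro exI[of _ h]) auto
  then show ?thesis
    using homotopic_with[of X P Y f g, OF assms(5)] by blast
qed

lemma continuous_map_fst_interval:
  "continuous_map (prod_topology (top_of_set S) X) euclidean fst"
  by (rule continuous_map_into_fulltopology[of _ _ S]) (rule continuous_map_fst)

lemma continuous_map_compose_snd:
  "continuous_map X Y f \<Longrightarrow> continuous_map (prod_topology W X) Y (\<lambda>z. f (snd z))"
  using continuous_map_compose[OF continuous_map_snd] by (auto simp: o_def)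

lemma continuous_map_compose_fst:
  "continuous_map X Y f \<Longrightarrow> continuous_map (prod_topology X W) Y (\<lambda>z. f (fst z))"
  using continuous_map_compose[OF continuous_map_fst] by (auto simp: o_def)

text \<open>A free nullhomotopy \<open>H\<close> of \<open>u\<close> moves the base point along the path \<open>H (\<cdot>, x0)\<close>. Running it
  only up to time \<open>m x\<close>, with \<open>m = 0\<close> near \<open>x0\<close>, keeps the base point fixed and ends in a map that
  factors through this path, which is then contracted.\<close>

lemma based_nullhomotopy:
  assumes u: "homotopic_maps X Y u (\<lambda>_. c)"
    and r: "continuous_map X X r" and h: "continuous_map X euclideanreal h"
    and x0: "x0 \<in> topspace X" and rh: "\<And>x. x \<in> topspace X \<Longrightarrow> 0 \<le> h x \<Longrightarrow> r x = x0"
  shows "homotopic_with (\<lambda>k. \<forall>x\<in>topspace X. 1/2 \<le> h x \<longrightarrow> k x = u x0) X Y (u \<circ> r) (\<lambda>_. u x0)"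
proof -
  obtain H where H: "continuous_map (prod_topology (top_of_set {0..1::real}) X) Y H"
    and H0: "\<And>x. H (0, x) = u x" and H1: "\<And>x. H (1, x) = c"
    using u by (auto simp: homotopic_with_def)
  \<comment> \<open>\<open>m\<close> is \<open>0\<close> where \<open>1/2 \<le> h\<close> and
    \<open>1\<close> where \<open>h \<le> 0\<close>, so \<open>r x\<close> can differ from
    \<open>x0\<close> only where the homotopy has already reached \<open>c\<close>. Hence
    \<open>H (m x, r x)\<close> depends on \<open>x\<close> only through \<open>m x\<close>.\<close>
  define m where "m x = max 0 (min 1 (1 - 2 * h x))" for x
  have m01: "0 \<le> m x" "m x \<le> 1" for x by (auto simp: m_def)
  have m: "continuous_map X euclideanreal m"
    unfolding m_def by (intro continuous_intros h)
  have m2: "continuous_map (prod_topology (top_of_set {0..1::real}) X) euclideanreal (\<lambda>z. m (snd z))"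
    by (rule continuous_map_compose_snd[OF m])
  have "homotopic_with (\<lambda>k. \<forall>x\<in>topspace X. 1/2 \<le> h x \<longrightarrow> k x = u x0) X Y (u \<circ> r) (\<lambda>x. H (m x, r x))"
  proof (rule homotopic_withI)
    show "continuous_map (prod_topology (top_of_set {0..1}) X) Y (\<lambda>z. H (fst z * m (snd z), r (snd z)))"
      by (rule continuous_map_homotopy[OF H])
        (auto intro!: continuous_map_real_mult continuous_map_fst_interval m2
          continuous_map_compose_snd r mult_nonneg_nonneg mult_le_one m01)
  qed (use rh in \<open>auto simp: H0 m_def\<close>)
  moreover
  have "homotopic_with (\<lambda>k. \<forall>x\<in>topspace X. 1/2 \<le> h x \<longrightarrow> k x = u x0) X Y (\<lambda>x. H (m x, r x)) (\<lambda>_. u x0)"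
  proof (rule homotopic_withI)
    show "continuous_map (prod_topology (top_of_set {0..1}) X) Y (\<lambda>z. H ((1 - fst z) * m (snd z), x0))"
      by (rule continuous_map_homotopy[OF H])
        (auto intro!: continuous_map_real_mult continuous_map_diff continuous_map_fst_interval m2
          x0 mult_nonneg_nonneg mult_le_one m01)
    fix x assume x: "x \<in> topspace X"
    show "H ((1 - fst (0, x)) * m (snd (0, x)), x0) = H (m x, r x)"
      by (cases "0 \<le> h x") (auto simp: rh x m_def H1)
  qed (auto simp: H0 m_def)
  ultimately show ?thesis
    by (rule homotopic_with_trans)
qed

text \<open>Near each axis \<open>G\<close> is replaced by a based nullhomotopy of its restriction to that axis, run for a time
  that grows from \<open>0\<close> to \<open>1\<close> on approaching the axis. Near the corner both nullhomotopies are constant.\<close>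

lemma homotopic_vanishing_on_axes:
  fixes G :: "'a \<times> 'a \<Rightarrow> 'a"
  assumes G: "continuous_map (prod_topology X X) X G" and G0: "G (x0, x0) = x0"
    and left: "nullhomotopic X X (\<lambda>y. G (x0, y))"
    and right: "nullhomotopic X X (\<lambda>x. G (x, x0))"
    and r: "homotopic_maps X X r id" and h: "continuous_map X euclideanreal h"
    and x0: "x0 \<in> topspace X" and hx0: "1 \<le> h x0"
    and rh: "\<And>x. x \<in> topspace X \<Longrightarrow> 0 \<le> h x \<Longrightarrow> r x = x0"
  obtains G' where "homotopic_maps (prod_topology X X) X G G'"
    "\<And>x. x \<in> topspace X \<Longrightarrow> G' (x, x0) = x0" "\<And>x. x \<in> topspace X \<Longrightarrow> G' (x0, x) = x0"
proof -
  let ?I = "top_of_set {0..1::real}"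
  have rc: "continuous_map X X r"
    using r homotopic_with_imp_continuous_maps by blast
  obtain Ka where Ka: "continuous_map (prod_topology ?I X) X Ka"
    "\<And>x. Ka (0, x) = G (r x, x0)" "\<And>x. Ka (1, x) = x0"
    "\<And>t x. 0 \<le> t \<Longrightarrow> t \<le> 1 \<Longrightarrow> x \<in> topspace X \<Longrightarrow> 1/2 \<le> h x \<Longrightarrow> Ka (t, x) = x0"
  proof -
    obtain c where "homotopic_maps X X (\<lambda>x. G (x, x0)) (\<lambda>_. c)" using right by blast
    from based_nullhomotopy[OF this rc h x0 rh] that G0 show ?thesis
      unfolding homotopic_with_def o_def by auto
  qed
  obtain Kb where Kb: "continuous_map (prod_topology ?I X) X Kb"
    "\<And>x. Kb (0, x) = G (x0, r x)" "\<And>x. Kb (1, x) = x0"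
    "\<And>t x. 0 \<le> t \<Longrightarrow> t \<le> 1 \<Longrightarrow> x \<in> topspace X \<Longrightarrow> 1/2 \<le> h x \<Longrightarrow> Kb (t, x) = x0"
  proof -
    obtain c where "homotopic_maps X X (\<lambda>x. G (x0, x)) (\<lambda>_. c)" using left by blast
    from based_nullhomotopy[OF this rc h x0 rh] that G0 show ?thesis
      unfolding homotopic_with_def o_def by auto
  qed
  \<comment> \<open>\<open>0 \<le> k\<close> describes the region \<open>1/2 \<le> h\<close>, where
    \<open>Ka\<close> and \<open>Kb\<close> stay at \<open>x0\<close>. The clamped time
    \<open>n\<close> is \<open>0\<close> on its boundary, for gluing, and \<open>1\<close> at
    \<open>x0\<close>.\<close>
  define k where "k x = 2 * h x - 1" for x
  define n where "n x = max 0 (min 1 (k x))" for x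
  have n01: "0 \<le> n x" "n x \<le> 1" for x by (auto simp: n_def)
  have kc: "continuous_map X euclideanreal k"
    unfolding k_def by (intro continuous_intros h)
  have nc: "continuous_map X euclideanreal n"
    unfolding n_def by (intro continuous_intros kc)
  let ?IX = "prod_topology ?I (prod_topology X X)"
  have p1: "continuous_map ?IX X (\<lambda>z. fst (snd z))"
    by (intro continuous_map_compose_snd continuous_map_fst)
  have p2: "continuous_map ?IX X (\<lambda>z. snd (snd z))"
    by (intro continuous_map_compose_snd continuous_map_snd)
  define D where "D z = (if 0 \<le> k (fst (snd z)) then Kb (fst z * n (fst (snd z)), snd (snd z))
      else G (r (fst (snd z)), r (snd (snd z))))" for z :: "real \<times> 'a \<times> 'a"
  \<comment> \<open>In the corner, where \<open>0 \<le> k\<close> holds for both coordinates,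
    \<open>Ka\<close> and \<open>Kb\<close> both give \<open>x0\<close>, so overriding
    \<open>D\<close> there does no harm.\<close>
  define E where "E z = (if 0 \<le> k (snd (snd z)) then Ka (fst z * n (snd (snd z)), fst (snd z))
      else D z)" for z :: "real \<times> 'a \<times> 'a"
  have comp: "continuous_map ?IX Z (\<lambda>z. f (g z))"
    if "continuous_map ?IX X g" "continuous_map X Z f" for f g and Z :: "'z topology"
    using continuous_map_compose[OF that] by (simp add: o_def)
  have D: "continuous_map ?IX X D"
    unfolding D_def
  proof (rule continuous_map_cases_le)
    show "continuous_map ?IX euclideanreal (\<lambda>z. k (fst (snd z)))"
      by (rule comp[OF p1 kc])
    show "continuous_map (subtopology ?IX {x \<in> topspace ?IX. 0 \<le> k (fst (snd x))}) X
            (\<lambda>z. Kb (fst z * n (fst (snd z)), snd (snd z)))"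
      by (rule continuous_map_from_subtopology, rule continuous_map_homotopy[OF Kb(1)])
        (auto intro!: continuous_map_real_mult continuous_map_fst_interval comp[OF p1 nc] p2
           mult_nonneg_nonneg mult_le_one n01)
    have "continuous_map ?IX X (\<lambda>z. G (r (fst (snd z)), r (snd (snd z))))"
      using continuous_map_compose[OF continuous_map_pairedI[OF comp[OF p1 rc] comp[OF p2 rc]] G]
      by (simp add: o_def)
    then show "continuous_map (subtopology ?IX {x \<in> topspace ?IX. k (fst (snd x)) \<le> 0}) X
            (\<lambda>z. G (r (fst (snd z)), r (snd (snd z))))"
      by (rule continuous_map_from_subtopology)
    fix z assume "z \<in> topspace ?IX" "0 = k (fst (snd z))"
    then show "Kb (fst z * n (fst (snd z)), snd (snd z)) = G (r (fst (snd z)), r (snd (snd z)))"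
      using rh[of "fst (snd z)"] by (auto simp: n_def Kb k_def)
  qed simp
  have E: "continuous_map ?IX X E"
    unfolding E_def
  proof (rule continuous_map_cases_le)
    show "continuous_map ?IX euclideanreal (\<lambda>z. k (snd (snd z)))"
      by (rule comp[OF p2 kc])
    show "continuous_map (subtopology ?IX {x \<in> topspace ?IX. 0 \<le> k (snd (snd x))}) X
            (\<lambda>z. Ka (fst z * n (snd (snd z)), fst (snd z)))"
      by (rule continuous_map_from_subtopology, rule continuous_map_homotopy[OF Ka(1)])
        (auto intro!: continuous_map_real_mult continuous_map_fst_interval comp[OF p2 nc] p1
           mult_nonneg_nonneg mult_le_one n01)
    show "continuous_map (subtopology ?IX {x \<in> topspace ?IX. k (snd (snd x)) \<le> 0}) X D"
      by (rule continuous_map_from_subtopology[OF D])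
    fix z assume z: "z \<in> topspace ?IX" "0 = k (snd (snd z))"
    then have y: "r (snd (snd z)) = x0" "1/2 \<le> h (snd (snd z))"
      using rh[of "snd (snd z)"] by (auto simp: k_def)
    show "Ka (fst z * n (snd (snd z)), fst (snd z)) = D z"
    proof (cases "0 \<le> k (fst (snd z))")
      case True
      then have "r (fst (snd z)) = x0"
        using rh[of "fst (snd z)"] z by (auto simp: k_def)
      moreover have "Kb (fst z * n (fst (snd z)), snd (snd z)) = x0"
        using z y by (intro Kb(4)) (auto intro!: mult_nonneg_nonneg mult_le_one n01)
      ultimately show ?thesis
        using z True by (auto simp: D_def n_def Ka G0)
    next
      case False
      then show ?thesis
        using z y by (auto simp: D_def n_def Ka)
    qed
  qed simp
  let ?G' = "\<lambda>p. E (1, p)"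
  have "homotopic_maps (prod_topology X X) X (\<lambda>z. G (r (fst z), r (snd z))) ?G'"
  proof (rule homotopic_withI[OF E])
    fix z assume z: "z \<in> topspace (prod_topology X X)"
    show "E (0, z) = G (r (fst z), r (snd z))"
      using rh[of "fst z"] rh[of "snd z"] z
      by (auto simp: E_def D_def Ka Kb k_def)
  qed auto
  moreover have "homotopic_maps (prod_topology X X) X G (\<lambda>z. G (r (fst z), r (snd z)))"
  proof -
    have "homotopic_maps (prod_topology X X) (prod_topology X X)
       (\<lambda>z. (r (fst z), r (snd z))) (\<lambda>z. (id (fst z), id (snd z)))"
      by (rule homotopic_with_prod_topology[OF r r]) simp
    from homotopic_with_compose_continuous_map_left[OF this G, of "\<lambda>_. True"]
    have "homotopic_maps (prod_topology X X) X (\<lambda>z. G (r (fst z), r (snd z))) G"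
      by (simp add: o_def)
    then show ?thesis by (rule homotopic_with_symD)
  qed
  ultimately have "homotopic_maps (prod_topology X X) X G ?G'"
    by (rule homotopic_with_trans[rotated])
  moreover have "?G' (x, x0) = x0" "?G' (x0, x) = x0" if x: "x \<in> topspace X" for x
  proof -
    have kn: "0 \<le> k x0" "n x0 = 1" "1/2 \<le> h x0" using hx0 by (auto simp: k_def n_def)
    show "?G' (x, x0) = x0" using kn by (simp add: E_def Ka)
    have "Ka (n x, x0) = x0" if "0 \<le> k x"
      using n01 kn x0 by (intro Ka(4)) auto
    then show "?G' (x0, x) = x0" using kn by (simp add: E_def D_def Kb)
  qed
  ultimately show ?thesis using that by blast
qed

text \<open>Once \<open>G\<close> vanishes on the axes, \<open>G (F x, \<phi> x)\<close> equals \<open>x0\<close> wherever one of \<open>F x\<close>, \<open>\<phi> x\<close> does, so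
  nesting \<open>G\<close> over the whole family \<open>\<phi>\<close> gives a constant map homotopic to the identity.\<close>

lemma contractible_if_axes_nullhomotopic:
  fixes G :: "'a \<times> 'a \<Rightarrow> 'a"
  assumes G: "continuous_map (prod_topology X X) X G" and G0: "G (x0, x0) = x0"
    and left: "nullhomotopic X X (\<lambda>y. G (x0, y))"
    and right: "nullhomotopic X X (\<lambda>x. G (x, x0))"
    and diag: "homotopic_maps X X (\<lambda>x. G (x, x)) id"
    and r: "homotopic_maps X X r id" and h: "continuous_map X euclideanreal h"
    and x0: "x0 \<in> topspace X" and hx0: "1 \<le> h x0"
    and rh: "\<And>x. x \<in> topspace X \<Longrightarrow> 0 \<le> h x \<Longrightarrow> r x = x0"
    and J: "finite J" and \<phi>: "\<And>i. i \<in> J \<Longrightarrow> homotopic_maps X X (\<phi> i) id"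
    and cover: "\<And>x. x \<in> topspace X \<Longrightarrow> \<exists>i\<in>J. \<phi> i x = x0"
  shows "contractible_space X"
proof -
  obtain G' where G': "homotopic_maps (prod_topology X X) X G G'"
    and ax: "\<And>x. x \<in> topspace X \<Longrightarrow> G' (x, x0) = x0" "\<And>x. x \<in> topspace X \<Longrightarrow> G' (x0, x) = x0"
    using homotopic_vanishing_on_axes[OF G G0 left right r h x0 hx0 rh] by blast
  have G'c: "continuous_map (prod_topology X X) X G'"
    using G' homotopic_with_imp_continuous_maps by blast
  have "homotopic_maps X X (\<lambda>x. G (x, x)) (\<lambda>x. G' (x, x))"
    using homotopic_with_compose_continuous_map_right[OF G', of X "\<lambda>x. (x, x)" "\<lambda>_. True"]
    by (simp add: o_def continuous_map_paired)
  then have diag': "homotopic_maps X X (\<lambda>x. G' (x, x)) id"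
    using diag homotopic_with_symD homotopic_with_trans by blast
  have "\<exists>F. homotopic_maps X X F id \<and> (\<forall>x\<in>topspace X. (\<exists>i\<in>J. \<phi> i x = x0) \<longrightarrow> F x = x0)"
    using J \<phi>
  proof (induction J rule: finite_induct)
    case empty
    then show ?case by (intro exI[of _ id]) auto
  next
    case (insert i J)
    then obtain F where F: "homotopic_maps X X F id"
      "\<And>x. x \<in> topspace X \<Longrightarrow> \<exists>i\<in>J. \<phi> i x = x0 \<Longrightarrow> F x = x0"
      by blast
    have i: "homotopic_maps X X (\<phi> i) id" by (rule insert.prems) simp
    have "homotopic_maps X X (\<lambda>x. G' (F x, \<phi> i x)) (\<lambda>x. G' (x, x))"
      using homotopic_with_compose_continuous_map_left[OF homotopic_maps_pair[OF F(1) i] G'c, of "\<lambda>_. True"]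
      by (simp add: o_def)
    then have "homotopic_maps X X (\<lambda>x. G' (F x, \<phi> i x)) id"
      using diag' by (rule homotopic_with_trans)
    moreover have "G' (F x, \<phi> i x) = x0"
      if "x \<in> topspace X" "\<exists>j\<in>insert i J. \<phi> j x = x0" for x
    proof -
      have "F x \<in> topspace X" "\<phi> i x \<in> topspace X"
        using that homotopic_maps_in_topspace F(1) i by metis+
      moreover have "\<phi> i x = x0 \<or> F x = x0" using that F(2) by blast
      ultimately show ?thesis using ax by metis
    qed
    ultimately show ?case by blast
  qed
  then obtain F where F: "homotopic_maps X X F id" "\<And>x. x \<in> topspace X \<Longrightarrow> F x = x0"
    using cover by blast
  have "homotopic_maps X X (\<lambda>_. x0) id"
    by (rule homotopic_maps_cong[OF F(1)]) (simp_all add: F(2))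
  then have "homotopic_maps X X id (\<lambda>_. x0)"
    by (rule homotopic_with_symD)
  then show ?thesis
    unfolding contractible_space_def by blast
qed

text \<open>The region \<open>0 \<le> k\<close> is sent to the single point \<open>q\<close>, which
  can be dragged along a path to \<open>x0\<close>. The travel time is \<open>0\<close> where
  \<open>k = 0\<close>, so the map stays continuous, and complete where \<open>1 \<le> k\<close>.
  This gives all members of the cover the same target.\<close>

lemma homotopic_move_along_path:
  assumes u: "homotopic_maps X X u id" and k: "continuous_map X euclideanreal k"
    and uk: "\<And>x. x \<in> topspace X \<Longrightarrow> 0 \<le> k x \<Longrightarrow> u x = q" and p: "path_component_of X q x0"
  obtains u' where "homotopic_maps X X u' id" "\<And>x. x \<in> topspace X \<Longrightarrow> 1 \<le> k x \<Longrightarrow> u' x = x0"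
proof -
  let ?I = "top_of_set {0..1::real}"
  obtain g where g: "continuous_map ?I X g" "g 0 = q" "g 1 = x0"
    using p by (auto simp: path_component_of_def pathin_def)
  have uc: "continuous_map X X u" using u homotopic_with_imp_continuous_maps by blast
  define n where "n x = max 0 (min 1 (k x))" for x
  have n01: "0 \<le> n x" "n x \<le> 1" for x by (auto simp: n_def)
  have nc: "continuous_map X euclideanreal n"
    unfolding n_def by (intro continuous_intros k)
  define E where "E z = (if 0 \<le> k (snd z) then g (fst z * n (snd z)) else u (snd z))"
    for z :: "real \<times> 'a"
  have "continuous_map (prod_topology ?I X) X E"
    unfolding E_def
  proof (rule continuous_map_cases_le)
    have "continuous_map (prod_topology ?I X) ?I (\<lambda>z. fst z * n (snd z))"
      by (rule continuous_map_into_subtopology)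
        (auto intro!: continuous_map_real_mult continuous_map_fst_interval
          continuous_map_compose_snd nc mult_nonneg_nonneg mult_le_one n01)
    from continuous_map_compose[OF this g(1)]
    show "continuous_map (subtopology (prod_topology ?I X) {x \<in> topspace (prod_topology ?I X). 0 \<le> k (snd x)}) X
            (\<lambda>z. g (fst z * n (snd z)))"
      by (intro continuous_map_from_subtopology) (simp add: o_def)
  qed (auto intro!: continuous_map_compose_snd k uc continuous_map_from_subtopology simp: n_def g uk)
  then have "homotopic_maps X X u (\<lambda>x. E (1, x))"
    by (rule homotopic_withI) (auto simp: E_def g uk)
  then have "homotopic_maps X X (\<lambda>x. E (1, x)) id"
    using u homotopic_with_symD homotopic_with_trans by blast
  moreover have "E (1, x) = x0" if "1 \<le> k x" for x
    using that by (simp add: E_def n_def g)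
  ultimately show ?thesis using that by blast
qed

section \<open>Simplicial maps and the realization\<close>

definition support :: "'a scomplex \<Rightarrow> ('a \<Rightarrow> real) \<Rightarrow> 'a set" where
  "support A t = {v\<in>verts A. t v \<noteq> 0}"

text \<open>Barycentric coordinates are probability weights on the vertices, and this is the image
  measure. \<open>realize\<close> pushes weights along a vertex map, \<open>realize2\<close> pushes
  product weights along a binary operation.\<close>

definition pushforward :: "'i set \<Rightarrow> 'b set \<Rightarrow> ('i \<Rightarrow> 'b) \<Rightarrow> ('i \<Rightarrow> real) \<Rightarrow> 'b \<Rightarrow> real" where
  "pushforward I W u m = (\<lambda>w\<in>W. \<Sum>i\<in>{i\<in>I. u i = w}. m i)"

lemma pushforward_nonneg:
  assumes "\<And>i. i \<in> I \<Longrightarrow> 0 \<le> m i" "w \<in> W"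
  shows "0 \<le> pushforward I W u m w"
  using assms by (auto simp: pushforward_def intro!: sum_nonneg)

lemma pushforward_support:
  assumes "finite I" "u ` I \<subseteq> W" "\<And>i. i \<in> I \<Longrightarrow> 0 \<le> m i"
  shows "{w\<in>W. pushforward I W u m w \<noteq> 0} = u ` {i\<in>I. m i \<noteq> 0}"
proof -
  have "pushforward I W u m w \<noteq> 0 \<longleftrightarrow> (\<exists>i\<in>I. u i = w \<and> m i \<noteq> 0)" if "w \<in> W" for w
  proof -
    have "sum m {i \<in> I. u i = w} = 0 \<longleftrightarrow> (\<forall>i\<in>{i \<in> I. u i = w}. m i = 0)"
      using assms(1,3) by (intro sum_nonneg_eq_0_iff) auto
    then show ?thesis using that by (auto simp: pushforward_def)
  qed
  then show ?thesis
    using assms(2) by auto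
qed

lemma sum_pushforward:
  assumes "finite I" "finite W" "u ` I \<subseteq> W"
  shows "(\<Sum>w\<in>W. pushforward I W u m w) = (\<Sum>i\<in>I. m i)"
  using sum.group[OF assms, of m] by (simp add: pushforward_def)

definition vertex_point :: "'a scomplex \<Rightarrow> 'a \<Rightarrow> 'a \<Rightarrow> real" where
  "vertex_point A v = (\<lambda>w\<in>verts A. if w = v then 1 else 0)"

definition realize :: "'a scomplex \<Rightarrow> 'b scomplex \<Rightarrow> ('a \<Rightarrow> 'b) \<Rightarrow> ('a \<Rightarrow> real) \<Rightarrow> 'b \<Rightarrow> real" where
  "realize A B u t = pushforward (verts A) (verts B) u t"

text \<open>Curried form of a simplicial map on the square: every face of the square lies in the
  product of its two projections, so testing products of faces suffices.\<close>

definition simplicial_map2 :: "'a scomplex \<Rightarrow> ('a \<Rightarrow> 'a \<Rightarrow> 'a) \<Rightarrow> bool" where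
  "simplicial_map2 A g \<longleftrightarrow>
     (\<forall>x\<in>verts A. \<forall>y\<in>verts A. g x y \<in> verts A) \<and>
     (\<forall>\<sigma>\<in>faces A. \<forall>\<tau>\<in>faces A. case_prod g ` (\<sigma> \<times> \<tau>) \<in> faces A)"

definition realize2 :: "'a scomplex \<Rightarrow> ('a \<Rightarrow> 'a \<Rightarrow> 'a) \<Rightarrow> ('a \<Rightarrow> real) \<times> ('a \<Rightarrow> real) \<Rightarrow> 'a \<Rightarrow> real" where
  "realize2 A g p = pushforward (verts A \<times> verts A) (verts A) (case_prod g) (\<lambda>(x, y). fst p x * snd p y)"

text \<open>Connectedness is kept combinatorial because walks along edges are what simplicial maps
  carry over to smaller complexes.\<close>

definition edge_connected :: "'a scomplex \<Rightarrow> bool" where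
  "edge_connected A \<longleftrightarrow> (\<forall>x\<in>verts A. \<forall>y\<in>verts A. (x, y) \<in> {(x, y). {x, y} \<in> faces A}\<^sup>*)"

locale finite_complex =
  fixes A :: "'a scomplex"
  assumes complex: "abstract_simplicial_complex A" and finite_verts: "finite (verts A)"
begin

abbreviation V where "V \<equiv> verts A"
abbreviation X where "X \<equiv> geometric_realization A"

lemma face_subset: "\<sigma> \<in> faces A \<Longrightarrow> \<tau> \<subseteq> \<sigma> \<Longrightarrow> \<tau> \<in> faces A"
  and face_verts: "\<sigma> \<in> faces A \<Longrightarrow> \<sigma> \<subseteq> V"
  and face_single: "v \<in> V \<Longrightarrow> {v} \<in> faces A"
  and face_finite: "\<sigma> \<in> faces A \<Longrightarrow> finite \<sigma>"
  using complex by (auto simp: abstract_simplicial_complex_def)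

lemma sum_support: "sum t (support A t) = sum t V"
  unfolding support_def by (rule sum.mono_neutral_left) (auto simp: finite_verts)

lemma topspace_realization:
  "t \<in> topspace X \<longleftrightarrow> t \<in> extensional V \<and> (\<forall>v\<in>V. 0 \<le> t v) \<and> support A t \<in> faces A \<and> sum t V = 1"
  using sum_support[of t]
  by (auto simp: geometric_realization_def support_def PiE_def)

lemma continuous_map_realization:
  "continuous_map Y X \<phi> \<longleftrightarrow>
     (\<forall>y\<in>topspace Y. \<phi> y \<in> topspace X) \<and> (\<forall>v\<in>V. continuous_map Y euclideanreal (\<lambda>y. \<phi> y v))"
proof -
  have "continuous_map Y X \<phi> \<longleftrightarrow> continuous_map Y (powertop_real V) \<phi> \<and> (\<forall>y\<in>topspace Y. \<phi> y \<in> topspace X)"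
    unfolding geometric_realization_def continuous_map_in_subtopology
    by (auto simp: continuous_map_def)
  then show ?thesis
    by (auto simp: continuous_map_componentwise geometric_realization_def PiE_iff)
qed

lemma continuous_map_coordinate:
  "v \<in> V \<Longrightarrow> continuous_map X euclideanreal (\<lambda>t. t v)"
  using continuous_map_realization[of X id] by (simp add: o_def)

lemma point_ext:
  assumes "s \<in> extensional V" "t \<in> extensional V" "\<And>v. v \<in> V \<Longrightarrow> s v = t v"
  shows "s = t"
  using assms by (rule extensionalityI)

lemma convex_combination_in_realization:
  assumes "s \<in> topspace X" "t \<in> topspace X" "0 \<le> a" "a \<le> 1"
    and F: "support A s \<union> support A t \<in> faces A"
  shows "(\<lambda>v\<in>V. (1 - a) * s v + a * t v) \<in> topspace X"
proof -
  have "support A (\<lambda>v\<in>V. (1 - a) * s v + a * t v) \<subseteq> support A s \<union> support A t"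
    by (auto simp: support_def)
  then have "support A (\<lambda>v\<in>V. (1 - a) * s v + a * t v) \<in> faces A"
    using F face_subset by blast
  moreover have "(\<Sum>v\<in>V. (1 - a) * s v + a * t v) = 1"
    using assms(1,2) by (simp add: sum.distrib sum_distrib_left[symmetric] topspace_realization)
  ultimately show ?thesis
    using assms(1-4) by (auto simp: topspace_realization)
qed

text \<open>The straight-line homotopy never leaves the simplex spanned by the two supports.\<close>

lemma homotopic_contiguous:
  assumes \<phi>: "continuous_map Y X \<phi>" and \<psi>: "continuous_map Y X \<psi>"
    and F: "\<And>y. y \<in> topspace Y \<Longrightarrow> support A (\<phi> y) \<union> support A (\<psi> y) \<in> faces A"
  shows "homotopic_maps Y X \<phi> \<psi>"
proof (rule homotopic_withI)
  have T: "\<phi> y \<in> topspace X" "\<psi> y \<in> topspace X" if "y \<in> topspace Y" for y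
    using \<phi> \<psi> that by (auto simp: continuous_map_realization)
  show "continuous_map (prod_topology (top_of_set {0..1}) Y) X
      (\<lambda>z. \<lambda>v\<in>V. (1 - fst z) * \<phi> (snd z) v + fst z * \<psi> (snd z) v)" (is "continuous_map ?IY X ?h")
    unfolding continuous_map_realization
  proof (intro conjI ballI)
    fix z assume "z \<in> topspace ?IY"
    then show "?h z \<in> topspace X"
      using T F by (auto intro!: convex_combination_in_realization)
  next
    fix v assume v: "v \<in> V"
    have "continuous_map ?IY euclideanreal (\<lambda>z. (1 - fst z) * \<phi> (snd z) v + fst z * \<psi> (snd z) v)"
      using \<phi> \<psi> v unfolding continuous_map_realization
      by (intro continuous_map_add continuous_map_real_mult continuous_map_diff
          continuous_map_fst_interval continuous_map_compose_snd[where f="\<lambda>y. \<phi> y v"]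
          continuous_map_compose_snd[where f="\<lambda>y. \<psi> y v"]) auto
    then show "continuous_map ?IY euclideanreal (\<lambda>z. ?h z v)"
      using v by simp
  qed
  show "(\<lambda>v\<in>V. (1 - fst (0, y)) * \<phi> (snd (0, y)) v + fst (0, y) * \<psi> (snd (0, y)) v) = \<phi> y"
    "(\<lambda>v\<in>V. (1 - fst (1, y)) * \<phi> (snd (1, y)) v + fst (1, y) * \<psi> (snd (1, y)) v) = \<psi> y"
    if "y \<in> topspace Y" for y
    using T[OF that] by (auto intro!: point_ext simp: topspace_realization)
qed auto

lemma support_vertex_point: "v \<in> V \<Longrightarrow> support A (vertex_point A v) = {v}"
  by (auto simp: support_def vertex_point_def)

lemma vertex_point_in_realization: "v \<in> V \<Longrightarrow> vertex_point A v \<in> topspace X"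
  using support_vertex_point[of v] finite_verts
  by (auto simp: topspace_realization face_single) (auto simp: vertex_point_def)

lemma support_nonempty:
  assumes "t \<in> topspace X" obtains v where "v \<in> V" "v \<in> support A t"
proof -
  have "sum t (support A t) = 1"
    using assms by (simp add: sum_support topspace_realization)
  then have "support A t \<noteq> {}" by auto
  then show ?thesis using that by (auto simp: support_def)
qed

lemma path_component_contiguous:
  assumes "s \<in> topspace X" "t \<in> topspace X" "support A s \<union> support A t \<in> faces A"
  shows "path_component_of X s t"
proof -
  have "homotopic_maps X X (\<lambda>_. s) (\<lambda>_. t)"
    by (rule homotopic_contiguous) (use assms in auto)
  then show ?thesis
    using assms(1) unfolding homotopic_constant_maps by auto
qed

lemma path_connected_realization:
  assumes "edge_connected A" shows "path_connected_space X"
proof -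
  have *: "path_component_of X (vertex_point A v) (vertex_point A w)" if "v \<in> V" "w \<in> V" for v w
  proof -
    have "(v, w) \<in> {(x, y). {x, y} \<in> faces A}\<^sup>*"
      using assms that by (auto simp: edge_connected_def)
    then show ?thesis
    proof (induction rule: rtrancl_induct)
      case base
      then show ?case using vertex_point_in_realization[OF that(1)] by (simp add: path_component_of_refl)
    next
      case (step y z)
      then have yz: "{y, z} \<in> faces A" by simp
      then have "y \<in> V" "z \<in> V" using face_verts by auto
      then have "path_component_of X (vertex_point A y) (vertex_point A z)"
        using yz by (intro path_component_contiguous)
          (auto simp: vertex_point_in_realization support_vertex_point insert_commute)
      then show ?case using step.IH path_component_of_trans by metis
    qed
  qed
  have **: "\<exists>v\<in>V. path_component_of X t (vertex_point A v)" if t: "t \<in> topspace X" for t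
  proof -
    obtain v where v: "v \<in> V" "v \<in> support A t" using support_nonempty[OF t] .
    have "support A t \<union> {v} = support A t" using v by auto
    then have "path_component_of X t (vertex_point A v)"
      using v t by (intro path_component_contiguous)
        (auto simp: vertex_point_in_realization support_vertex_point topspace_realization[of t])
    then show ?thesis using v by auto
  qed
  show ?thesis
    unfolding path_connected_space_iff_path_component
    using * ** by (meson path_component_of_sym path_component_of_trans)
qed

end

lemma realize_cong:
  assumes "\<And>x. x \<in> verts A \<Longrightarrow> u x = w x"
  shows "realize A B u = realize A B w"
proof -
  have "{i \<in> verts A. u i = v} = {i \<in> verts A. w i = v}" for v
    using assms by auto
  then show ?thesis
    by (simp add: realize_def pushforward_def fun_eq_iff)
qed

lemma support_realize:
  assumes "finite_complex A" "simplicial_map A B u" "t \<in> topspace (geometric_realization A)"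
  shows "support B (realize A B u t) = u ` support A t"
proof -
  interpret A: finite_complex A by fact
  show ?thesis
    unfolding support_def realize_def using assms
    by (intro pushforward_support) (auto simp: A.finite_verts simplicial_map_def A.topspace_realization)
qed

lemma realize_in_realization:
  assumes "finite_complex A" "finite_complex B" "simplicial_map A B u"
    "t \<in> topspace (geometric_realization A)"
  shows "realize A B u t \<in> topspace (geometric_realization B)"
proof -
  interpret A: finite_complex A by fact
  interpret B: finite_complex B by fact
  have "support B (realize A B u t) \<in> faces B"
    using assms support_realize[OF assms(1,3,4)] by (auto simp: simplicial_map_def A.topspace_realization)
  moreover have "sum (realize A B u t) (verts B) = 1"
    using assms unfolding realize_def
    by (subst sum_pushforward) (auto simp: A.finite_verts B.finite_verts simplicial_map_def A.topspace_realization)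
  moreover have "0 \<le> realize A B u t v" if "v \<in> verts B" for v
    using assms that by (auto simp: realize_def A.topspace_realization intro!: pushforward_nonneg)
  ultimately show ?thesis
    by (auto simp: B.topspace_realization realize_def pushforward_def)
qed

lemma continuous_map_realize:
  assumes "finite_complex A" "finite_complex B" "simplicial_map A B u"
  shows "continuous_map (geometric_realization A) (geometric_realization B) (realize A B u)"
proof -
  interpret A: finite_complex A by fact
  interpret B: finite_complex B by fact
  show ?thesis
    unfolding B.continuous_map_realization
    by (auto simp: realize_in_realization[OF assms])
      (auto simp: realize_def pushforward_def A.finite_verts intro!: continuous_map_sum A.continuous_map_coordinate)
qed

lemma realize_compose:
  assumes "finite_complex A" "finite_complex B" "u ` verts A \<subseteq> verts B"
  shows "realize B C w (realize A B u t) = realize A C (w \<circ> u) t"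
proof -
  interpret A: finite_complex A by fact
  interpret B: finite_complex B by fact
  have "(\<Sum>v\<in>{v\<in>verts B. w v = z}. \<Sum>x\<in>{x\<in>verts A. u x = v}. t x) = (\<Sum>x\<in>{x\<in>verts A. w (u x) = z}. t x)" for z
  proof -
    have "(\<Sum>v\<in>{v\<in>verts B. w v = z}. \<Sum>x\<in>{x\<in>verts A. u x = v}. t x) =
      (\<Sum>v\<in>{v\<in>verts B. w v = z}. \<Sum>x\<in>{x\<in>{x\<in>verts A. w (u x) = z}. u x = v}. t x)"
      by (intro sum.cong refl) auto
    also have "\<dots> = (\<Sum>x\<in>{x\<in>verts A. w (u x) = z}. t x)"
      using assms(3) by (intro sum.group) (auto simp: A.finite_verts B.finite_verts)
    finally show ?thesis .
  qed
  then show ?thesis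
    by (auto simp: realize_def pushforward_def fun_eq_iff)
qed

section \<open>Multilinear extensions and the closed cover\<close>

context finite_complex
begin

lemma finite_complex_self: "finite_complex A"
  by unfold_locales

lemma realize_id:
  assumes "t \<in> topspace X" shows "realize A A (\<lambda>x. x) t = t"
proof (rule point_ext)
  fix v assume "v \<in> V"
  then have "{i \<in> V. i = v} = {v}" by auto
  then show "realize A A (\<lambda>x. x) t v = t v"
    using \<open>v \<in> V\<close> by (simp add: realize_def pushforward_def)
qed (use assms in \<open>auto simp: topspace_realization realize_def pushforward_def\<close>)

lemma realize2_support:
  assumes "simplicial_map2 A g" "s \<in> topspace X" "t \<in> topspace X"
  shows "support A (realize2 A g (s, t)) = case_prod g ` (support A s \<times> support A t)"
proof -
  have "support A (realize2 A g (s, t)) = case_prod g ` {p \<in> V \<times> V. (case p of (x, y) \<Rightarrow> s x * t y) \<noteq> 0}"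
    unfolding support_def realize2_def fst_conv snd_conv using assms
    by (intro pushforward_support) (auto simp: finite_verts simplicial_map2_def topspace_realization)
  also have "{p \<in> V \<times> V. (case p of (x, y) \<Rightarrow> s x * t y) \<noteq> 0} = support A s \<times> support A t"
    by (auto simp: support_def)
  finally show ?thesis .
qed

lemma realize2_in_realization:
  assumes "simplicial_map2 A g" "s \<in> topspace X" "t \<in> topspace X"
  shows "realize2 A g (s, t) \<in> topspace X"
proof -
  have "support A (realize2 A g (s, t)) \<in> faces A"
    using assms realize2_support[OF assms] by (auto simp: simplicial_map2_def topspace_realization)
  moreover have "sum (realize2 A g (s, t)) V = (\<Sum>p\<in>V \<times> V. case p of (x, y) \<Rightarrow> s x * t y)"
    using assms unfolding realize2_def fst_conv snd_conv
    by (intro sum_pushforward) (auto simp: finite_verts simplicial_map2_def)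
  moreover have "\<dots> = sum s V * sum t V"
    by (simp add: sum_product sum.cartesian_product)
  moreover have "0 \<le> realize2 A g (s, t) v" if "v \<in> V" for v
    using assms that by (auto simp: realize2_def topspace_realization intro!: pushforward_nonneg)
  ultimately show ?thesis
    using assms by (auto simp: topspace_realization realize2_def pushforward_def)
qed

lemma continuous_map_realize2:
  assumes "simplicial_map2 A g"
  shows "continuous_map (prod_topology X X) X (realize2 A g)"
  unfolding continuous_map_realization
proof (intro conjI ballI)
  fix z assume "z \<in> topspace (prod_topology X X)"
  then show "realize2 A g z \<in> topspace X"
    using realize2_in_realization[OF assms] by auto
next
  fix v assume v: "v \<in> V"
  have "continuous_map (prod_topology X X) euclideanreal
      (\<lambda>z. \<Sum>p\<in>{p \<in> V \<times> V. case_prod g p = v}. fst z (fst p) * snd z (snd p))"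
    by (intro continuous_map_sum continuous_map_real_mult
        continuous_map_compose_fst[where f="\<lambda>t. t (fst _)"]
        continuous_map_compose_snd[where f="\<lambda>t. t (snd _)"] continuous_map_coordinate)
      (auto simp: finite_verts)
  then show "continuous_map (prod_topology X X) euclideanreal (\<lambda>z. realize2 A g z v)"
    using v by (simp add: realize2_def pushforward_def case_prod_unfold)
qed

lemma realize2_vertex_left:
  assumes "v \<in> V" shows "realize2 A g (vertex_point A v, t) = realize A A (g v) t"
proof
  fix w
  have "(\<Sum>p\<in>{p \<in> V \<times> V. case_prod g p = w}. vertex_point A v (fst p) * t (snd p)) =
      (\<Sum>p\<in>Pair v ` {y \<in> V. g v y = w}. vertex_point A v (fst p) * t (snd p))"
    using assms by (intro sum.mono_neutral_right) (auto simp: finite_verts vertex_point_def)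
  also have "\<dots> = (\<Sum>y\<in>{y \<in> V. g v y = w}. t y)"
    using assms by (subst sum.reindex) (auto simp: inj_on_def vertex_point_def)
  finally show "realize2 A g (vertex_point A v, t) w = realize A A (g v) t w"
    by (simp add: realize2_def realize_def pushforward_def case_prod_unfold)
qed

lemma realize2_vertex_right:
  assumes "v \<in> V" shows "realize2 A g (t, vertex_point A v) = realize A A (\<lambda>x. g x v) t"
proof
  fix w
  have "(\<Sum>p\<in>{p \<in> V \<times> V. case_prod g p = w}. t (fst p) * vertex_point A v (snd p)) =
      (\<Sum>p\<in>(\<lambda>x. (x, v)) ` {x \<in> V. g x v = w}. t (fst p) * vertex_point A v (snd p))"
    using assms by (intro sum.mono_neutral_right) (auto simp: finite_verts vertex_point_def)
  also have "\<dots> = (\<Sum>x\<in>{x \<in> V. g x v = w}. t x)"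
    using assms by (subst sum.reindex) (auto simp: inj_on_def vertex_point_def)
  finally show "realize2 A g (t, vertex_point A v) w = realize A A (\<lambda>x. g x v) t w"
    by (simp add: realize2_def realize_def pushforward_def case_prod_unfold)
qed

lemma realize_vertex:
  assumes "v \<in> V" "u v \<in> V" shows "realize A A u (vertex_point A v) = vertex_point A (u v)"
proof
  fix w
  have "(\<Sum>i\<in>{i \<in> V. u i = w}. vertex_point A v i) = (\<Sum>i\<in>{i \<in> V. u i = w}. if i = v then 1 else 0)"
    by (rule sum.cong) (auto simp: vertex_point_def)
  also have "\<dots> = (if u v = w then 1 else 0)"
    using assms by (simp add: finite_verts)
  finally show "realize A A u (vertex_point A v) w = vertex_point A (u v) w"
    by (auto simp: realize_def pushforward_def vertex_point_def)
qed

text \<open>The left side spreads weight over all \<open>g (u a) (w b)\<close> with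
  \<open>a\<close>, \<open>b\<close> in the support, the right side only over those with
  \<open>a = b\<close>. The maps differ in general, but both supports lie in one face.\<close>

lemma homotopic_realize2:
  assumes g: "simplicial_map2 A g" and u: "simplicial_map A A u" and w: "simplicial_map A A w"
  shows "homotopic_maps X X (\<lambda>t. realize2 A g (realize A A u t, realize A A w t)) (realize A A (\<lambda>x. g (u x) (w x)))"
proof (rule homotopic_contiguous)
  note S = finite_complex_self
  have uw: "simplicial_map A A (\<lambda>x. g (u x) (w x))"
    unfolding simplicial_map_def
  proof (intro conjI ballI)
    fix \<sigma> assume "\<sigma> \<in> faces A"
    then have "case_prod g ` (u ` \<sigma> \<times> w ` \<sigma>) \<in> faces A"
      using g u w by (auto simp: simplicial_map2_def simplicial_map_def)
    then show "(\<lambda>x. g (u x) (w x)) ` \<sigma> \<in> faces A"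
      by (rule face_subset) auto
  qed (use g u w in \<open>auto simp: simplicial_map2_def simplicial_map_def Pi_iff\<close>)
  show "continuous_map X X (\<lambda>t. realize2 A g (realize A A u t, realize A A w t))"
    using continuous_map_compose[OF _ continuous_map_realize2[OF g],
        of X "\<lambda>t. (realize A A u t, realize A A w t)"]
    by (simp add: o_def continuous_map_paired continuous_map_realize[OF S S] u w)
  show "continuous_map X X (realize A A (\<lambda>x. g (u x) (w x)))"
    by (rule continuous_map_realize[OF S S uw])
  fix t assume t: "t \<in> topspace X"
  have "support A (realize A A (\<lambda>x. g (u x) (w x)) t) \<subseteq> case_prod g ` (u ` support A t \<times> w ` support A t)"
    using support_realize[OF S uw t] by auto
  moreover have "support A (realize2 A g (realize A A u t, realize A A w t)) =
      case_prod g ` (u ` support A t \<times> w ` support A t)"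
    by (simp add: realize2_support[OF g] realize_in_realization[OF S S] support_realize[OF S] u w t)
  moreover have "case_prod g ` (u ` support A t \<times> w ` support A t) \<in> faces A"
    using g u w t by (auto simp: simplicial_map2_def simplicial_map_def topspace_realization)
  ultimately show "support A (realize2 A g (realize A A u t, realize A A w t)) \<union>
      support A (realize A A (\<lambda>x. g (u x) (w x)) t) \<in> faces A"
    by (simp add: Un_absorb2)
qed

lemma homotopic_realize2_diagonal:
  assumes g: "simplicial_map2 A g" and idem: "\<And>x. x \<in> V \<Longrightarrow> g x x = x"
  shows "homotopic_maps X X (\<lambda>t. realize2 A g (t, t)) id"
proof -
  have "simplicial_map A A (\<lambda>x. x)"
    by (auto simp: simplicial_map_def)
  from homotopic_realize2[OF g this this] show ?thesis
    by (rule homotopic_maps_cong) (use realize_cong[of A "\<lambda>x. g x x" "\<lambda>x. x" A] idem in \<open>auto simp: realize_id\<close>)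
qed

text \<open>The fraction of the way travelled grows with \<open>t v\<close>: points with
  \<open>t v = 0\<close>, which may share no face with \<open>v\<close>, do not move, and points
  with \<open>1 \<le> c * t v\<close> arrive at \<open>v\<close>.\<close>

definition push_towards :: "'a \<Rightarrow> real \<Rightarrow> ('a \<Rightarrow> real) \<Rightarrow> 'a \<Rightarrow> real" where
  "push_towards v c t =
     (\<lambda>w\<in>V. (1 - min 1 (c * t v)) * t w + min 1 (c * t v) * vertex_point A v w)"

lemma homotopic_push_towards:
  assumes v: "v \<in> V" and c: "0 \<le> c"
  shows "homotopic_maps X X (push_towards v c) id"
proof (rule homotopic_contiguous)
  have sup: "support A (push_towards v c t) \<subseteq> support A t" for t
    using v by (auto simp: support_def push_towards_def vertex_point_def split: if_splits)
  have *: "push_towards v c t \<in> topspace X" if t: "t \<in> topspace X" for t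
  proof (cases "t v = 0")
    case True
    then have "push_towards v c t = t"
      using t by (intro point_ext) (auto simp: push_towards_def topspace_realization)
    then show ?thesis using t by simp
  next
    case False
    then have "support A t \<union> {v} = support A t" using v by (auto simp: support_def)
    then show ?thesis
      unfolding push_towards_def using t v c
      by (intro convex_combination_in_realization)
        (auto simp: topspace_realization[of t] vertex_point_in_realization support_vertex_point)
  qed
  show "continuous_map X X (push_towards v c)"
    unfolding continuous_map_realization
  proof (intro conjI ballI *)
    fix w assume w: "w \<in> V"
    have "continuous_map X euclideanreal
        (\<lambda>t. (1 - min 1 (c * t v)) * t w + min 1 (c * t v) * vertex_point A v w)"
      by (intro continuous_map_add continuous_map_real_mult continuous_map_diff continuous_map_real_min
          continuous_map_coordinate v w) auto
    then show "continuous_map X euclideanreal (\<lambda>t. push_towards v c t w)"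
      using w by (simp add: push_towards_def)
  qed
  show "support A (push_towards v c t) \<union> support A (id t) \<in> faces A" if "t \<in> topspace X" for t
    using that sup[of t] by (simp add: topspace_realization Un_absorb1)
qed auto

lemma push_towards_eq_vertex_point:
  assumes "v \<in> V" "1 \<le> c * t v"
  shows "push_towards v c t = vertex_point A v"
  using assms by (auto simp: push_towards_def vertex_point_def fun_eq_iff)

lemma contractible_if_binary_axes_null:
  assumes conn: "edge_connected A" and x0: "x0 \<in> V"
    and g: "simplicial_map2 A g" and idem: "\<And>x. x \<in> V \<Longrightarrow> g x x = x"
    and left: "nullhomotopic X X (realize A A (g x0))"
    and right: "nullhomotopic X X (realize A A (\<lambda>x. g x x0))"
  shows "contractible_space X"
proof -
  let ?p = "vertex_point A x0" and ?N = "real (card V)"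
  have p: "?p \<in> topspace X" by (rule vertex_point_in_realization[OF x0])
  have N: "0 < ?N" using x0 finite_verts by (auto simp: card_gt_0_iff)
  have "\<exists>\<phi>. homotopic_maps X X \<phi> id \<and> (\<forall>t\<in>topspace X. 1 \<le> ?N * t v \<longrightarrow> \<phi> t = ?p)" if v: "v \<in> V" for v
  proof -
    have q: "path_component_of X (vertex_point A v) ?p"
      using path_connected_realization[OF conn] vertex_point_in_realization[OF v] p
      by (auto simp: path_connected_space_iff_path_component)
    \<comment> \<open>With factor \<open>2 * ?N\<close> the push reaches \<open>v\<close> as soon as
      \<open>1 / (2 * ?N) \<le> t v\<close>, that is \<open>0 \<le> k\<close>. The range up to
      \<open>1 / ?N\<close>, that is \<open>1 \<le> k\<close>, is left for the path to
      \<open>?p\<close>.\<close>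
    have k: "continuous_map X euclideanreal (\<lambda>t. 2 * ?N * t v - 1)"
      using v by (intro continuous_map_diff continuous_map_real_mult continuous_map_coordinate) auto
    show ?thesis
      by (rule homotopic_move_along_path[OF homotopic_push_towards[OF v, of "2 * ?N"] k _ q])
        (use v in \<open>auto simp: push_towards_eq_vertex_point\<close>)
  qed
  then obtain \<phi> where \<phi>: "\<And>v. v \<in> V \<Longrightarrow> homotopic_maps X X (\<phi> v) id"
    "\<And>v t. v \<in> V \<Longrightarrow> t \<in> topspace X \<Longrightarrow> 1 \<le> ?N * t v \<Longrightarrow> \<phi> v t = ?p"
    by metis
  \<comment> \<open>The \<open>card V\<close> coordinates of a point add up to \<open>1\<close>, so
    one of them is at least \<open>1 / ?N\<close>.\<close>
  have cover: "\<exists>v\<in>V. \<phi> v t = ?p" if t: "t \<in> topspace X" for t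
  proof (rule ccontr)
    assume "\<not> ?thesis"
    then have "?N * t v < 1" if "v \<in> V" for v
      using \<phi>(2)[OF that t] that by force
    then have "sum t V < (\<Sum>v\<in>V. 1 / ?N)"
      using N x0 finite_verts by (intro sum_strict_mono) (auto simp: field_simps)
    then show False
      using t N by (simp add: topspace_realization)
  qed
  \<comment> \<open>This is nonnegative where the push with factor \<open>2\<close> has arrived at
    \<open>x0\<close>, and equals \<open>1\<close> at the vertex itself.\<close>
  have h: "continuous_map X euclideanreal (\<lambda>t. 2 * t x0 - 1)"
    using x0 by (intro continuous_map_diff continuous_map_real_mult continuous_map_coordinate) auto
  show ?thesis
  proof (rule contractible_if_axes_nullhomotopic[OF continuous_map_realize2[OF g] _ _ _
        homotopic_realize2_diagonal[OF g idem] homotopic_push_towards[OF x0, of 2] h p _ _ finite_verts \<phi>(1) cover])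
    show "realize2 A g (?p, ?p) = ?p"
      using x0 g idem by (simp add: realize2_vertex_left realize_vertex simplicial_map2_def)
    show "nullhomotopic X X (\<lambda>y. realize2 A g (?p, y))"
      using left x0 by (simp add: realize2_vertex_left)
    show "nullhomotopic X X (\<lambda>x. realize2 A g (x, ?p))"
      using right x0 by (simp add: realize2_vertex_right)
    show "push_towards x0 2 t = ?p" if "0 \<le> 2 * t x0 - 1" for t
      using that x0 by (simp add: push_towards_eq_vertex_point)
  qed (use x0 in \<open>auto simp: vertex_point_def\<close>)
qed

end

section \<open>Simplicial self-maps and binary polymorphisms\<close>

lemma exists_idempotent_power:
  assumes fin: "finite S" and u: "u ` S \<subseteq> S"
  obtains m where "0 < m" "\<And>x. x \<in> S \<Longrightarrow> (u ^^ m) ((u ^^ m) x) = (u ^^ m) x"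
proof -
  have uk: "(u ^^ k) x \<in> S" if "x \<in> S" for k x
    using that u by (induction k) auto
  let ?p = "\<lambda>k. restrict (u ^^ k) S"
  have "range ?p \<subseteq> S \<rightarrow>\<^sub>E S" using uk by auto
  then have "finite (range ?p)" by (rule finite_subset) (simp add: fin finite_PiE)
  then have "\<not> inj ?p" using finite_imageD infinite_UNIV_nat by blast
  then obtain i j where "i < j" and eq: "?p i = ?p j"
    unfolding inj_def by (metis linorder_neqE_nat)
  define d where "d = j - i"
  have d: "0 < d" "j = i + d" using \<open>i < j\<close> by (auto simp: d_def)
  have period: "(u ^^ (k + d)) x = (u ^^ k) x" if "i \<le> k" "x \<in> S" for k x
  proof -
    have "(u ^^ (k + d)) x = (u ^^ (k - i)) ((u ^^ j) x)"
      using that d by (simp flip: funpow_add comp_apply[of "u ^^ _" "u ^^ _"])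
    also have "\<dots> = (u ^^ (k - i)) ((u ^^ i) x)"
      using fun_cong[OF eq, of x] that by simp
    also have "\<dots> = (u ^^ k) x"
      using that by (simp flip: funpow_add comp_apply[of "u ^^ _" "u ^^ _"])
    finally show ?thesis .
  qed
  have periods: "(u ^^ (k + q * d)) x = (u ^^ k) x" if "i \<le> k" "x \<in> S" for k q x
  proof (induction q)
    case (Suc q)
    have "(u ^^ (k + Suc q * d)) x = (u ^^ ((k + q * d) + d)) x" by (simp add: algebra_simps)
    then show ?case using Suc period[of "k + q * d" x] that by simp
  qed simp
  \<comment> \<open>A positive multiple of the period \<open>d\<close> that is at least the
    preperiod \<open>i\<close>.\<close>
  let ?m = "Suc i * d"
  have "i \<le> ?m" using d by (cases d) auto
  then have "(u ^^ ?m) ((u ^^ ?m) x) = (u ^^ ?m) x" if "x \<in> S" for x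
    using periods[of ?m x "Suc i"] that by (simp only: funpow_add comp_apply)
  with d show ?thesis by (intro that[of ?m]) auto
qed

lemma not_inj_on_compose: "\<not> inj_on u S \<Longrightarrow> \<not> inj_on (\<lambda>x. w (u x)) S"
  using inj_on_imageI2[of w u S] by (auto simp: o_def)

context finite_complex
begin

abbreviation "smap \<equiv> simplicial_map A A"
abbreviation "nullmap u \<equiv> nullhomotopic X X (realize A A u)"

lemma smap_in_verts: "smap u \<Longrightarrow> x \<in> V \<Longrightarrow> u x \<in> V"
  by (auto simp: simplicial_map_def)

lemma smap_id: "smap (\<lambda>x. x)"
  by (auto simp: simplicial_map_def)

lemma smap_compose: "smap u \<Longrightarrow> smap w \<Longrightarrow> smap (\<lambda>x. u (w x))"
  by (auto simp: simplicial_map_def Pi_iff simp flip: image_image)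

lemma smap_funpow: "smap u \<Longrightarrow> smap (u ^^ k)"
proof (induction k)
  case 0 then show ?case by (simp add: simplicial_map_def)
next
  case (Suc k) then show ?case using smap_compose[of u "u ^^ k"] by (simp add: o_def)
qed

lemma continuous_map_smap: "smap u \<Longrightarrow> continuous_map X X (realize A A u)"
  by (rule continuous_map_realize[OF finite_complex_self finite_complex_self])

lemma realize_smap_compose: "smap w \<Longrightarrow> realize A A (\<lambda>x. u (w x)) = realize A A u \<circ> realize A A w"
  using realize_compose[OF finite_complex_self finite_complex_self, of w A u]
  by (auto simp: fun_eq_iff o_def simplicial_map_def image_subset_iff Pi_iff)

lemma nullmap_compose_left:
  assumes "nullmap w" "smap u" "smap w"
  shows "nullmap (\<lambda>x. u (w x))"
proof -
  obtain c where "homotopic_maps X X (realize A A w) (\<lambda>_. c)" using assms(1) by blast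
  from homotopic_with_compose_continuous_map_left[OF this continuous_map_smap[OF assms(2)], of "\<lambda>_. True"]
  have "homotopic_maps X X (realize A A (\<lambda>x. u (w x))) (\<lambda>_. realize A A u c)"
    by (simp add: realize_smap_compose[OF assms(3)] o_def)
  then show ?thesis by blast
qed

lemma realize_const:
  assumes "t \<in> topspace X" shows "realize A A (\<lambda>_. c) t = vertex_point A c"
proof
  fix w
  have "{i \<in> V. c = w} = (if w = c then V else {})" by auto
  then show "realize A A (\<lambda>_. c) t w = vertex_point A c w"
    using assms by (simp add: realize_def pushforward_def vertex_point_def topspace_realization)
qed

lemma contractible_if_nullmap_id:
  assumes "nullmap u" "\<And>x. x \<in> V \<Longrightarrow> u x = x"
  shows "contractible_space X"
proof -
  obtain c where "homotopic_maps X X (realize A A u) (\<lambda>_. c)" using assms(1) by blast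
  then have "homotopic_maps X X id (\<lambda>_. c)"
    by (rule homotopic_maps_cong)
      (use assms(2) realize_cong[of A u "\<lambda>x. x" A] in \<open>auto simp: realize_id\<close>)
  then show ?thesis by (auto simp: contractible_space_def)
qed

text \<open>An injective idempotent map is the identity.\<close>

lemma smap_power_id:
  assumes "smap u" "inj_on u V"
  obtains m where "0 < m" "\<And>x. x \<in> V \<Longrightarrow> (u ^^ m) x = x"
proof -
  have uV: "u ` V \<subseteq> V" using smap_in_verts[OF assms(1)] by auto
  obtain m where m: "0 < m" "\<And>x. x \<in> V \<Longrightarrow> (u ^^ m) ((u ^^ m) x) = (u ^^ m) x"
    using exists_idempotent_power[OF finite_verts uV] by blast
  have inj: "inj_on (u ^^ k) V" for k
  proof (induction k)
    case (Suc k)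
    have "(u ^^ k) ` V \<subseteq> V" using smap_in_verts[OF smap_funpow[OF assms(1)]] by auto
    then have "inj_on (u \<circ> (u ^^ k)) V"
      by (intro comp_inj_on[OF Suc] inj_on_subset[OF assms(2)])
    then show ?case by (simp only: funpow.simps)
  qed simp
  have "(u ^^ m) x = x" if "x \<in> V" for x
    using inj_onD[OF inj[of m] m(2)[OF that] smap_in_verts[OF smap_funpow[OF assms(1)] that] that] .
  with m show ?thesis using that by blast
qed

text \<open>The inverse is found as a power of \<open>u\<close>, and this is what makes it
  simplicial; a simplicial bijection between different complexes may fail to have a simplicial
  inverse.\<close>

lemma smap_inverse:
  assumes "smap u" "inj_on u V"
  obtains w where "smap w" "\<And>x. x \<in> V \<Longrightarrow> w (u x) = x"
proof -
  obtain m where m: "0 < m" "\<And>x. x \<in> V \<Longrightarrow> (u ^^ m) x = x"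
    using smap_power_id[OF assms] by blast
  then obtain k where "m = Suc k" by (cases m) auto
  then have "(u ^^ k) (u x) = x" if "x \<in> V" for x
    using m(2)[OF that] by (simp add: funpow_swap1)
  then show ?thesis using that smap_funpow[OF assms(1)] by blast
qed

lemma simplicial_map2_fst: "simplicial_map2 A (\<lambda>x y. x)"
  unfolding simplicial_map2_def by (auto intro: face_subset)

lemma simplicial_map2_snd: "simplicial_map2 A (\<lambda>x y. y)"
  unfolding simplicial_map2_def by (auto intro: face_subset)

lemma simplicial_map2_const: "c \<in> V \<Longrightarrow> simplicial_map2 A (\<lambda>x y. c)"
  unfolding simplicial_map2_def by (auto intro: face_subset[OF face_single])

lemma simplicial_map2_compose:
  assumes "simplicial_map2 A g" "simplicial_map2 A p" "simplicial_map2 A q"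
  shows "simplicial_map2 A (\<lambda>x y. g (p x y) (q x y))"
  unfolding simplicial_map2_def
proof (intro conjI ballI)
  fix \<sigma> \<tau> assume "\<sigma> \<in> faces A" "\<tau> \<in> faces A"
  then have "case_prod g ` (case_prod p ` (\<sigma> \<times> \<tau>) \<times> case_prod q ` (\<sigma> \<times> \<tau>)) \<in> faces A"
    using assms by (auto simp: simplicial_map2_def)
  then show "(\<lambda>(x, y). g (p x y) (q x y)) ` (\<sigma> \<times> \<tau>) \<in> faces A"
    by (rule face_subset) auto
qed (use assms in \<open>auto simp: simplicial_map2_def\<close>)

lemma simplicial_map2_smap:
  assumes "smap w" "simplicial_map2 A g"
  shows "simplicial_map2 A (\<lambda>x y. w (g x y))"
  unfolding simplicial_map2_def
proof (intro conjI ballI)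
  fix \<sigma> \<tau> assume "\<sigma> \<in> faces A" "\<tau> \<in> faces A"
  then have "w ` case_prod g ` (\<sigma> \<times> \<tau>) \<in> faces A"
    using assms by (auto simp: simplicial_map2_def simplicial_map_def)
  then show "(\<lambda>(x, y). w (g x y)) ` (\<sigma> \<times> \<tau>) \<in> faces A"
    by (simp add: image_image case_prod_unfold)
qed (use assms in \<open>auto simp: simplicial_map2_def simplicial_map_def\<close>)

lemma smap_left:
  assumes "simplicial_map2 A g" "c \<in> V" shows "smap (g c)"
  unfolding simplicial_map_def
proof (intro conjI ballI)
  fix \<sigma> assume "\<sigma> \<in> faces A"
  then have "case_prod g ` ({c} \<times> \<sigma>) \<in> faces A"
    using assms face_single by (auto simp: simplicial_map2_def)
  then show "g c ` \<sigma> \<in> faces A" by (rule face_subset) auto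
qed (use assms in \<open>auto simp: simplicial_map2_def\<close>)

lemma smap_right:
  assumes "simplicial_map2 A g" "c \<in> V" shows "smap (\<lambda>x. g x c)"
  using smap_left[OF simplicial_map2_compose[OF assms(1) simplicial_map2_snd simplicial_map2_fst] assms(2)] .

lemma smap_diagonal:
  assumes "simplicial_map2 A g" shows "smap (\<lambda>x. g x x)"
proof (cases "V = {}")
  case True
  have "(\<lambda>x. g x x) ` \<sigma> \<in> faces A" if "\<sigma> \<in> faces A" for \<sigma>
    using face_verts[OF that] that True by simp
  then show ?thesis using True by (auto simp: simplicial_map_def)
next
  case False
  \<comment> \<open>The diagonal is the translation at any vertex of the operation
    \<open>\<lambda>x y. g y y\<close>, so some vertex is needed.\<close>
  then obtain c where "c \<in> V" by auto
  then show ?thesis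
    using smap_left[OF simplicial_map2_compose[OF assms simplicial_map2_snd simplicial_map2_snd]] by simp
qed

text \<open>Both maps are slices of the multilinear extension, taken at two points that a path
  joins.\<close>

lemma homotopic_translations:
  assumes "edge_connected A" "simplicial_map2 A g" "c \<in> V" "d \<in> V"
  shows "homotopic_maps X X (realize A A (g c)) (realize A A (g d))"
proof -
  have "path_component_of X (vertex_point A c) (vertex_point A d)"
    using path_connected_realization[OF assms(1)] assms vertex_point_in_realization
    by (auto simp: path_connected_space_iff_path_component)
  then have "homotopic_maps X X (\<lambda>_. vertex_point A c) (\<lambda>_. vertex_point A d)"
    by (simp add: homotopic_constant_maps)
  then have "homotopic_maps X (prod_topology X X) (\<lambda>t. (vertex_point A c, id t)) (\<lambda>t. (vertex_point A d, id t))"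
    by (rule homotopic_maps_pair) simp
  from homotopic_with_compose_continuous_map_left[OF this continuous_map_realize2[OF assms(2)], of "\<lambda>_. True"]
  show ?thesis
    using assms by (simp add: o_def realize2_vertex_left)
qed

lemma homotopic_funpow:
  assumes "smap u" "smap w" "homotopic_maps X X (realize A A u) (realize A A w)"
  shows "homotopic_maps X X (realize A A (u ^^ k)) (realize A A (w ^^ k))"
proof (induction k)
  case 0
  show ?case using continuous_map_smap[OF smap_id] by (simp add: id_def)
next
  case (Suc k)
  from homotopic_compose[OF this assms(3)] show ?case
    using realize_smap_compose[OF smap_funpow[OF assms(1)], of u k]
      realize_smap_compose[OF smap_funpow[OF assms(2)], of w k]
    by (simp add: o_def)
qed

lemma contractible_if_simplex:
  assumes "V \<in> faces A" shows "contractible_space X"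
proof (cases "topspace X = {}")
  case True then show ?thesis by (metis contractible_space_empty null_topspace_iff_trivial)
next
  case False
  then obtain t where t: "t \<in> topspace X" by blast
  have "homotopic_maps X X id (\<lambda>_. t)"
    by (rule homotopic_contiguous)
      (use t assms in \<open>auto intro!: face_subset[OF assms] simp: support_def\<close>)
  then show ?thesis by (auto simp: contractible_space_def)
qed

text \<open>A face \<open>\<sigma>\<close> of maximal size satisfies \<open>g \<sigma> x = g \<sigma> y\<close> for every edge \<open>{x, y}\<close>, because
  \<open>g (\<sigma> \<times> {x, y})\<close> is a face.\<close>

lemma simplex_if_quasigroup:
  assumes conn: "edge_connected A" and g: "simplicial_map2 A g" and ne: "V \<noteq> {}"
    and left: "\<And>c. c \<in> V \<Longrightarrow> inj_on (g c) V" and right: "\<And>c. c \<in> V \<Longrightarrow> inj_on (\<lambda>x. g x c) V"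
  shows "V \<in> faces A"
proof -
  have finF: "finite (faces A)"
    by (rule finite_subset[of _ "Pow V"]) (use face_verts finite_verts in auto)
  obtain v where v: "v \<in> V" using ne by auto
  have "Max (card ` faces A) \<in> card ` faces A"
    using finF face_single[OF v] by (intro Max_in) auto
  then obtain \<sigma> where \<sigma>: "\<sigma> \<in> faces A" and "card \<sigma> = Max (card ` faces A)" by auto
  then have max: "card \<tau> \<le> card \<sigma>" if "\<tau> \<in> faces A" for \<tau>
    using that finF by simp
  have "card \<sigma> \<noteq> 0" using max[OF face_single[OF v]] by simp
  then obtain a where a: "a \<in> \<sigma>" by fastforce
  have aV: "a \<in> V" using a \<sigma> face_verts by blast
  have step: "(\<lambda>s. g s x) ` \<sigma> = (\<lambda>s. g s y) ` \<sigma>" if xy: "{x, y} \<in> faces A" for x y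
  proof -
    let ?\<tau> = "case_prod g ` (\<sigma> \<times> {x, y})"
    have \<tau>: "?\<tau> \<in> faces A" using g \<sigma> xy by (auto simp: simplicial_map2_def)
    have "(\<lambda>s. g s z) ` \<sigma> = ?\<tau>" if z: "z \<in> {x, y}" for z
    proof (rule card_seteq)
      have "z \<in> V" using z xy face_verts by blast
      then have "card ((\<lambda>s. g s z) ` \<sigma>) = card \<sigma>"
        using \<sigma> face_verts by (intro card_image inj_on_subset[OF right]) auto
      then show "card ?\<tau> \<le> card ((\<lambda>s. g s z) ` \<sigma>)" using max[OF \<tau>] by simp
    qed (use z face_finite[OF \<tau>] in auto)
    then show ?thesis by auto
  qed
  have same: "(\<lambda>s. g s x) ` \<sigma> = (\<lambda>s. g s v) ` \<sigma>" if "x \<in> V" for x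
  proof -
    have "(v, x) \<in> {(x, y). {x, y} \<in> faces A}\<^sup>*"
      using conn v that by (auto simp: edge_connected_def)
    then show ?thesis
      by (induction rule: rtrancl_induct) (use step in auto)
  qed
  \<comment> \<open>Since \<open>a\<close> lies in \<open>\<sigma>\<close>, each
    \<open>g a x\<close> belongs to \<open>g \<sigma> x = g \<sigma> v\<close>, a fixed face, while
    \<open>g a\<close> is onto \<open>V\<close>.\<close>
  have "g a ` V = V"
    using left[OF aV] g aV by (intro endo_inj_surj finite_verts) (auto simp: simplicial_map2_def)
  moreover have "g a ` V \<subseteq> (\<lambda>s. g s v) ` \<sigma>"
  proof clarify
    fix x assume "x \<in> V"
    have "g a x \<in> (\<lambda>s. g s x) ` \<sigma>" using a by auto
    then show "g a x \<in> (\<lambda>s. g s v) ` \<sigma>" using same[OF \<open>x \<in> V\<close>] by simp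
  qed
  moreover have "(\<lambda>s. g s v) ` \<sigma> \<in> faces A"
    using smap_right[OF g v] \<sigma> by (auto simp: simplicial_map_def)
  ultimately show ?thesis using face_subset by metis
qed

end

text \<open>The induction over smaller complexes enters only through the second assumption, so the
  arguments in this locale never mention those complexes.\<close>

locale null_retractions = finite_complex +
  assumes connected: "edge_connected A"
    and idempotent_nullmap:
      "\<And>r. smap r \<Longrightarrow> (\<And>x. x \<in> V \<Longrightarrow> r (r x) = r x) \<Longrightarrow> \<not> inj_on r V \<Longrightarrow> nullmap r"
begin

lemma nullmap_power:
  assumes u: "smap u" and "\<not> inj_on u V"
  obtains m where "0 < m" "nullmap (u ^^ m)"
proof -
  have uV: "u ` V \<subseteq> V" using smap_in_verts[OF u] by auto
  obtain m where m: "0 < m" "\<And>x. x \<in> V \<Longrightarrow> (u ^^ m) ((u ^^ m) x) = (u ^^ m) x"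
    using exists_idempotent_power[OF finite_verts uV] by blast
  have "\<not> inj_on (u ^^ m) V"
  proof
    assume i: "inj_on (u ^^ m) V"
    obtain k where k: "m = Suc k" using m(1) by (cases m) auto
    then have "inj_on ((u ^^ k) \<circ> u) V" using i by (simp only: funpow_Suc_right)
    then have "inj_on u V" by (rule inj_on_imageI2)
    then show False using assms by simp
  qed
  then show ?thesis
    using that m idempotent_nullmap[OF smap_funpow[OF u]] by blast
qed

text \<open>If \<open>w\<close> were not injective, some \<open>w ^^ m\<close> and hence
  \<open>u ^^ m\<close> would be nullhomotopic. As \<open>u\<close> has finite order
  \<open>k\<close>, a further power of \<open>u\<close> completes \<open>u ^^ m\<close> to
  \<open>u ^^ (m * k)\<close>, the identity.\<close>

lemma inj_if_homotopic:
  assumes u: "smap u" "inj_on u V" and w: "smap w"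
    and h: "homotopic_maps X X (realize A A u) (realize A A w)" and nc: "\<not> contractible_space X"
  shows "inj_on w V"
proof (rule ccontr)
  assume "\<not> ?thesis"
  then obtain m where m: "0 < m" "nullmap (w ^^ m)" using nullmap_power[OF w] by blast
  then have null: "nullmap (u ^^ m)"
    using homotopic_funpow[OF u(1) w h, of m] homotopic_with_trans by blast
  obtain k where k: "0 < k" "\<And>x. x \<in> V \<Longrightarrow> (u ^^ k) x = x" using smap_power_id[OF u] by blast
  have "(u ^^ (j * k)) x = x" if "x \<in> V" for j x
    using that by (induction j) (auto simp: funpow_add k(2))
  moreover have "m * k = (m * k - m) + m" using k(1) by (cases k) auto
  ultimately have "(u ^^ (m * k - m)) ((u ^^ m) x) = x" if "x \<in> V" for x
    using that by (metis funpow_add comp_apply)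
  moreover have "nullmap (\<lambda>x. (u ^^ (m * k - m)) ((u ^^ m) x))"
    using null by (rule nullmap_compose_left) (intro smap_funpow u)+
  ultimately show False using contractible_if_nullmap_id nc by blast
qed

text \<open>Unless the realization is contractible, injectivity of the translations spreads from
  \<open>x0\<close> to all vertices along homotopies. The second side is the first one with the
  arguments swapped.\<close>

lemma contractible_if_quasigroup:
  assumes g: "simplicial_map2 A g" and x0: "x0 \<in> V"
    and left: "inj_on (g x0) V" and right: "inj_on (\<lambda>x. g x x0) V"
  shows "contractible_space X"
proof (rule ccontr)
  assume nc: "\<not> ?thesis"
  have "inj_on (g c) V" if "c \<in> V" for c
    by (rule inj_if_homotopic[OF smap_left[OF g x0] left smap_left[OF g that]
          homotopic_translations[OF connected g x0 that] nc])
  moreover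
  have g': "simplicial_map2 A (\<lambda>x y. g y x)"
    by (rule simplicial_map2_compose[OF g simplicial_map2_snd simplicial_map2_fst])
  have "inj_on (\<lambda>x. g x c) V" if "c \<in> V" for c
    by (rule inj_if_homotopic[OF smap_left[OF g' x0] right smap_left[OF g' that]
          homotopic_translations[OF connected g' x0 that] nc])
  ultimately show False
    using simplex_if_quasigroup[OF connected g] contractible_if_simplex nc x0 by blast
qed

text \<open>The diagonal is only asked to be injective because \<open>binary_family_step\<close> may
  produce the new diagonal \<open>\<lambda>x. h x (g x x0)\<close>, which need not be the
  identity.\<close>

definition binary_family :: "'a \<Rightarrow> ('a \<Rightarrow> 'a \<Rightarrow> 'a) set" where
  "binary_family x0 = {h. simplicial_map2 A h \<and> h x0 x0 = x0 \<and> inj_on (\<lambda>x. h x x) V \<and> \<not> inj_on (\<lambda>x. h x x0) V}"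

text \<open>Substituting \<open>g\<close> into the second argument of \<open>h\<close> gives \<open>h x (g y z)\<close>; identifying the new variables
  suitably stays in the family and multiplies the translation \<open>h x0\<close> from the right by a translation of \<open>g\<close>.\<close>

lemma binary_family_step:
  assumes x0: "x0 \<in> V" and g: "simplicial_map2 A g" and idem: "\<And>x. x \<in> V \<Longrightarrow> g x x = x"
    and left: "\<not> inj_on (g x0) V" and right: "\<not> inj_on (\<lambda>x. g x x0) V"
    and h: "h \<in> binary_family x0"
  obtains h' w where "h' \<in> binary_family x0" "smap w" "\<not> inj_on w V" "\<And>y. h' x0 y = h x0 (w y)"
proof -
  have hs: "simplicial_map2 A h" and h0: "h x0 x0 = x0" and hd: "inj_on (\<lambda>x. h x x) V"
    and hr: "\<not> inj_on (\<lambda>x. h x x0) V"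
    using h by (auto simp: binary_family_def)
  show ?thesis
  \<comment> \<open>This map is the diagonal of the first candidate \<open>h x (g y x0)\<close> and
    the right translation at \<open>x0\<close> of the second candidate \<open>h x (g x y)\<close>,
    so either outcome fits one of them.\<close>
  proof (cases "inj_on (\<lambda>x. h x (g x x0)) V")
    case True
    have "(\<lambda>x y. h x (g y x0)) \<in> binary_family x0"
      using True hr h0 idem[OF x0]
      by (auto simp: binary_family_def intro!: simplicial_map2_compose[OF hs] simplicial_map2_compose[OF g]
          simplicial_map2_fst simplicial_map2_snd simplicial_map2_const x0)
    then show ?thesis
      using that[of _ "\<lambda>y. g y x0"] smap_right[OF g x0] right by blast
  next
    case False
    have "inj_on (\<lambda>x. h x (g x x)) V"
      using hd idem by (simp cong: inj_on_cong)
    then have "(\<lambda>x y. h x (g x y)) \<in> binary_family x0"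
      using False h0 idem[OF x0]
      by (auto simp: binary_family_def intro!: simplicial_map2_compose[OF hs] simplicial_map2_compose[OF g]
          simplicial_map2_fst simplicial_map2_snd)
    then show ?thesis
      using that[of _ "g x0"] smap_left[OF g x0] left by blast
  qed
qed

text \<open>Choosing \<open>h\<close> with a minimal right ideal \<open>I (h x0)\<close> gives a translation satisfying \<open>h' x0 = h' x0 \<circ> v\<close> with
  \<open>v\<close> not injective; some power of \<open>v\<close> is nullhomotopic.\<close>

lemma exists_nullmap_translation:
  assumes x0: "x0 \<in> V" and g: "simplicial_map2 A g" and idem: "\<And>x. x \<in> V \<Longrightarrow> g x x = x"
    and left: "\<not> inj_on (g x0) V" and right: "\<not> inj_on (\<lambda>x. g x x0) V"
  obtains h where "h \<in> binary_family x0" "nullmap (h x0)"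
proof -
  define N where "N = {w. smap w \<and> \<not> inj_on w V}"
  \<comment> \<open>Restricting to \<open>V\<close> makes the ideal finite, so that its cardinality
    can be minimised.\<close>
  define I where "I u = (\<lambda>w. restrict (\<lambda>x. u (w x)) V) ` N" for u :: "'a \<Rightarrow> 'a"
  have finI: "finite (I (h x0))" if "h \<in> binary_family x0" for h
  proof (rule finite_subset)
    show "I (h x0) \<subseteq> V \<rightarrow>\<^sub>E V"
      using that x0 by (auto simp: I_def N_def binary_family_def simplicial_map2_def smap_in_verts)
  qed (simp add: finite_verts finite_PiE)
  have "g \<in> binary_family x0"
    using g idem right x0 by (auto simp: binary_family_def cong: inj_on_cong)
  then obtain h where h: "h \<in> binary_family x0"
    and min: "\<And>h'. h' \<in> binary_family x0 \<Longrightarrow> card (I (h x0)) \<le> card (I (h' x0))"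
    using ex_has_least_nat[of "\<lambda>h. h \<in> binary_family x0" g "\<lambda>h. card (I (h x0))"] by blast
  obtain h' w where h': "h' \<in> binary_family x0" and w: "smap w" "\<not> inj_on w V"
    and eq: "\<And>y. h' x0 y = h x0 (w y)"
    using binary_family_step[OF x0 g idem left right h] by blast
  have "I (h' x0) \<subseteq> I (h x0)"
  proof
    fix e assume "e \<in> I (h' x0)"
    then obtain v where v: "smap v" "\<not> inj_on v V" "e = restrict (\<lambda>x. h x0 (w (v x))) V"
      by (auto simp: I_def N_def eq)
    then have "(\<lambda>x. w (v x)) \<in> N"
      using smap_compose[OF w(1) v(1)] not_inj_on_compose[OF v(2)] by (simp add: N_def)
    then show "e \<in> I (h x0)" using v by (auto simp: I_def)
  qed
  then have "I (h' x0) = I (h x0)"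
    using finI[OF h] min[OF h'] by (intro card_seteq) auto
  \<comment> \<open>On \<open>V\<close>, \<open>h' x0\<close> is \<open>h x0\<close> after the
    non-injective \<open>w\<close>, so it lies in the ideal of \<open>h x0\<close>. By minimality
    this is its own ideal, and membership there is the equation
    \<open>h' x0 = h' x0 \<circ> v\<close>.\<close>
  moreover have "restrict (h' x0) V \<in> I (h x0)"
    using w by (auto simp: I_def N_def eq intro!: image_eqI[of _ _ w])
  ultimately obtain v where v: "smap v" "\<not> inj_on v V"
    and fix_v: "restrict (h' x0) V = restrict (\<lambda>x. h' x0 (v x)) V"
    by (auto simp: I_def N_def)
  have fix1: "h' x0 (v x) = h' x0 x" if "x \<in> V" for x
    using fun_cong[OF fix_v, of x] that by simp
  have fixk: "h' x0 ((v ^^ k) x) = h' x0 x" if "x \<in> V" for k x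
    using that by (induction k) (auto simp: fix1 smap_in_verts[OF smap_funpow[OF v(1)]])
  obtain m where m: "nullmap (v ^^ m)" using nullmap_power[OF v] .
  have "smap (h' x0)" using h' x0 smap_left by (auto simp: binary_family_def)
  then have "nullmap (\<lambda>x. h' x0 ((v ^^ m) x))"
    using nullmap_compose_left[OF m] smap_funpow[OF v(1)] by blast
  moreover have "realize A A (\<lambda>x. h' x0 ((v ^^ m) x)) = realize A A (h' x0)"
    by (rule realize_cong) (rule fixk)
  ultimately have "nullmap (h' x0)" by simp
  with h' show ?thesis using that by blast
qed

text \<open>Once the left translation of an idempotent \<open>p\<close> is nullhomotopic, iterating
  \<open>p\<close> in its first argument turns the right translation into a nullhomotopic power. The
  left translation survives: with \<open>q k x0\<close> homotopic to a constant,
  \<open>p (q k x0 y) y\<close> is homotopic to \<open>p x0 y\<close>.\<close>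

lemma contractible_if_noninjective_translations:
  assumes x0: "x0 \<in> V" and g: "simplicial_map2 A g" and diag: "inj_on (\<lambda>x. g x x) V"
    and left: "\<not> inj_on (g x0) V" and right: "\<not> inj_on (\<lambda>x. g x x0) V"
  shows "contractible_space X"
proof -
  \<comment> \<open>Composing with an inverse of the diagonal makes the operation idempotent and
    cannot make a non-injective translation injective.\<close>
  have idempotent: "\<exists>w. smap w \<and> (\<forall>x\<in>V. w (h x x) = x)"
    if h: "simplicial_map2 A h" "inj_on (\<lambda>x. h x x) V" for h
    by (rule smap_inverse[OF smap_diagonal[OF h(1)] h(2)]) auto
  obtain w where w: "smap w" "\<And>x. x \<in> V \<Longrightarrow> w (g x x) = x" using idempotent[OF g diag] by blast
  obtain h where h: "h \<in> binary_family x0" and hnull: "nullmap (h x0)"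
    using exists_nullmap_translation[OF x0 simplicial_map2_smap[OF w(1) g] w(2) not_inj_on_compose[OF left] not_inj_on_compose[OF right]] by blast
  have hs: "simplicial_map2 A h" and hd: "inj_on (\<lambda>x. h x x) V" and hr: "\<not> inj_on (\<lambda>x. h x x0) V"
    using h by (auto simp: binary_family_def)
  obtain w' where w': "smap w'" "\<And>x. x \<in> V \<Longrightarrow> w' (h x x) = x" using idempotent[OF hs hd] by blast
  define p where "p x y = w' (h x y)" for x y
  have p: "simplicial_map2 A p" unfolding p_def by (rule simplicial_map2_smap[OF w'(1) hs])
  have pi: "p x x = x" if "x \<in> V" for x using w' that by (simp add: p_def)
  have pnull: "nullmap (p x0)"
    unfolding p_def using nullmap_compose_left[OF hnull w'(1) smap_left[OF hs x0]] .
  have "\<not> inj_on (\<lambda>x. p x x0) V" unfolding p_def by (rule not_inj_on_compose[OF hr])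
  then obtain m where m: "nullmap ((\<lambda>x. p x x0) ^^ m)"
    using nullmap_power[OF smap_right[OF p x0]] by blast
  define q where "q k x y = ((\<lambda>z. p z y) ^^ k) x" for k x y
  have q0: "q 0 = (\<lambda>x y. x)" and qSuc: "q (Suc k) = (\<lambda>x y. p (q k x y) y)" for k
    by (simp_all add: q_def fun_eq_iff)
  have q: "simplicial_map2 A (q k)" for k
  proof (induction k)
    case 0 then show ?case using simplicial_map2_fst by (simp add: q0)
  next
    case (Suc k)
    from simplicial_map2_compose[OF p Suc simplicial_map2_snd] show ?case by (simp add: qSuc)
  qed
  have qi: "q k x x = x" if "x \<in> V" for k x
    using that by (induction k) (auto simp: q_def pi)
  have qnull: "nullmap (q k x0)" for k
  proof (induction k)
    case 0
    have "homotopic_maps X X (realize A A (\<lambda>_. x0)) (\<lambda>_. vertex_point A x0)"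
      by (rule homotopic_maps_cong[of X X "\<lambda>_. vertex_point A x0" "\<lambda>_. vertex_point A x0"])
        (simp_all add: vertex_point_in_realization[OF x0] realize_const)
    then show ?case unfolding q0 by blast
  next
    case (Suc k)
    then obtain c where c: "homotopic_maps X X (realize A A (q k x0)) (\<lambda>_. c)" by blast
    \<comment> \<open>The nullhomotopy may end at any point; moving that point to the vertex
      \<open>x0\<close> makes the slice below exactly \<open>p x0\<close>.\<close>
    have c0: "homotopic_maps X X (realize A A (q k x0)) (\<lambda>_. vertex_point A x0)"
    proof -
      have P: "vertex_point A x0 \<in> topspace X" by (rule vertex_point_in_realization[OF x0])
      then have "c \<in> topspace X"
        using homotopic_maps_in_topspace[OF homotopic_with_symD[OF c]] by blast
      then have "path_component_of X c (vertex_point A x0)"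
        using P path_connected_realization[OF connected] by (auto simp: path_connected_space_iff_path_component)
      then have "homotopic_maps X X (\<lambda>_. c) (\<lambda>_. vertex_point A x0)"
        by (simp add: homotopic_constant_maps)
      with c show ?thesis by (rule homotopic_with_trans)
    qed
    have "homotopic_maps X (prod_topology X X) (\<lambda>t. (realize A A (q k x0) t, realize A A (\<lambda>x. x) t))
        (\<lambda>t. (vertex_point A x0, id t))"
      by (rule homotopic_maps_pair[OF c0])
        (rule homotopic_maps_cong[of X X id id], auto simp: realize_id)
    from homotopic_with_compose_continuous_map_left[OF this continuous_map_realize2[OF p], of "\<lambda>_. True"]
    have "homotopic_maps X X (\<lambda>t. realize2 A p (realize A A (q k x0) t, realize A A (\<lambda>x. x) t)) (realize A A (p x0))"
      using x0 by (simp add: o_def realize2_vertex_left)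
    moreover have "realize A A (q (Suc k) x0) = realize A A (\<lambda>y. p (q k x0 y) y)"
      by (simp add: qSuc)
    ultimately have "homotopic_maps X X (realize A A (q (Suc k) x0)) (realize A A (p x0))"
      using homotopic_with_trans[OF homotopic_with_symD[OF homotopic_realize2[OF p smap_left[OF q x0] smap_id]]]
      by simp
    with pnull show ?case using homotopic_with_trans by blast
  qed
  have "nullmap (\<lambda>x. q m x x0)" using m by (simp add: q_def eta_contract_eq)
  then show ?thesis
    using contractible_if_binary_axes_null[OF connected x0 q qi qnull] by blast
qed

end

section \<open>Taylor polymorphisms\<close>

definition tuple_op :: "nat \<Rightarrow> ((nat \<Rightarrow> 'a) \<Rightarrow> 'a) \<Rightarrow> nat set \<Rightarrow> nat set \<Rightarrow> 'a \<Rightarrow> 'a \<Rightarrow> 'a \<Rightarrow> 'a" where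
  "tuple_op n f I J c x y = f (\<lambda>i\<in>{1..n}. if i \<in> I then x else if i \<in> J then y else c)"

context finite_complex
begin

lemma polymorphism_in_verts:
  assumes "polymorphism A n f" "\<And>i. i \<in> {1..n} \<Longrightarrow> t i \<in> V"
  shows "f (\<lambda>i\<in>{1..n}. t i) \<in> V"
  using assms by (auto simp: polymorphism_def simplicial_map_def power_complex_def Pi_iff)

lemma polymorphism_face:
  assumes "polymorphism A n f" "finite S" "S \<subseteq> {1..n} \<rightarrow>\<^sub>E V"
    "\<And>i. i \<in> {1..n} \<Longrightarrow> (\<lambda>t. t i) ` S \<in> faces A"
  shows "f ` S \<in> faces A"
  using assms by (auto simp: polymorphism_def simplicial_map_def power_complex_def)

lemma simplicial_map2_tuple_op:
  assumes f: "polymorphism A n f" and c: "c \<in> V"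
  shows "simplicial_map2 A (tuple_op n f I J c)"
  unfolding simplicial_map2_def
proof (intro conjI ballI)
  fix x y assume "x \<in> V" "y \<in> V"
  then show "tuple_op n f I J c x y \<in> V"
    unfolding tuple_op_def using c by (intro polymorphism_in_verts[OF f]) auto
next
  fix \<sigma> \<tau> assume \<sigma>: "\<sigma> \<in> faces A" and \<tau>: "\<tau> \<in> faces A"
  let ?t = "\<lambda>(x, y). \<lambda>i\<in>{1..n}. if i \<in> I then x else if i \<in> J then y else c"
  have "f ` ?t ` (\<sigma> \<times> \<tau>) \<in> faces A"
  proof (rule polymorphism_face[OF f])
    show "finite (?t ` (\<sigma> \<times> \<tau>))" using face_finite \<sigma> \<tau> by auto
    show "?t ` (\<sigma> \<times> \<tau>) \<subseteq> {1..n} \<rightarrow>\<^sub>E V"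
      using face_verts[OF \<sigma>] face_verts[OF \<tau>] c by (auto split: if_splits)
    fix i assume i: "i \<in> {1..n}"
    \<comment> \<open>In general \<open>\<rho>\<close> only contains the projection, since
      \<open>\<sigma> \<times> \<tau>\<close> is empty as soon as one factor is.\<close>
    define \<rho> where "\<rho> = (if i \<in> I then \<sigma> else if i \<in> J then \<tau> else {c})"
    have "\<rho> \<in> faces A" using \<sigma> \<tau> face_single[OF c] by (simp add: \<rho>_def)
    then show "(\<lambda>t. t i) ` ?t ` (\<sigma> \<times> \<tau>) \<in> faces A"
      by (rule face_subset) (use i in \<open>auto simp: \<rho>_def\<close>)
  qed
  then show "case_prod (tuple_op n f I J c) ` (\<sigma> \<times> \<tau>) \<in> faces A"
    by (simp add: image_image case_prod_unfold tuple_op_def)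
qed

end

text \<open>For a base vertex \<open>x0\<close> and a set \<open>I\<close> of coordinates, \<open>e I\<close> below places its argument on \<open>I\<close> and
  \<open>x0\<close> elsewhere. If some \<open>e {m}\<close> is injective, then \<open>e J\<close> can be injective only for \<open>m \<in> J\<close>, whereas the
  Taylor identity for \<open>m\<close> says \<open>e I = e J\<close> for some \<open>I\<close> containing \<open>m\<close> and some \<open>J\<close> not containing \<open>m\<close>.\<close>

lemma (in null_retractions) contractible_if_taylor:
  assumes f: "taylor_polymorphism A n f" and idem: "idempotent_op A n f" and ne: "V \<noteq> {}"
  shows "contractible_space X"
proof (rule ccontr)
  assume nc: "\<not> ?thesis"
  obtain x0 where x0: "x0 \<in> V" using ne by auto
  have pol: "polymorphism A n f" using f by (simp add: taylor_polymorphism_def)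
  have idem': "f (\<lambda>i\<in>{1..n}. x) = x" if "x \<in> V" for x
    using idem that by (simp add: idempotent_op_def)
  define e where "e I x = f (\<lambda>i\<in>{1..n}. if i \<in> I then x else x0)" for I x
  note g = simplicial_map2_tuple_op[OF pol x0]
  have left: "tuple_op n f I J x0 x0 = e J" if "I \<inter> J = {}" for I J
    unfolding tuple_op_def e_def using that by (intro ext arg_cong[of _ _ f]) auto
  have right: "(\<lambda>x. tuple_op n f I J x0 x x0) = e I" for I J
    unfolding tuple_op_def e_def by (intro ext arg_cong[of _ _ f]) auto
  have diag: "(\<lambda>x. tuple_op n f I J x0 x x) = e (I \<union> J)" for I J
    unfolding tuple_op_def e_def by (intro ext arg_cong[of _ _ f]) auto
  have disjoint: "\<not> (inj_on (e I) V \<and> inj_on (e J) V)" if "I \<inter> J = {}" for I J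
    using contractible_if_quasigroup[OF g x0, of I J] left[OF that] right[of I J] nc by auto
  have union: "inj_on (e I) V \<or> inj_on (e J) V" if "I \<inter> J = {}" "inj_on (e (I \<union> J)) V" for I J
    using contractible_if_noninjective_translations[OF x0 g, of I J] left[OF that(1)]
      right[of I J] diag[of I J] that(2) nc by auto
  have "e {1..n} x = x" if "x \<in> V" for x
    using idem'[OF that] by (simp add: e_def cong: restrict_cong)
  then have full: "inj_on (e {1..n}) V" by (simp add: inj_on_def)
  have "\<exists>m\<in>{1..n}. inj_on (e {m}) V"
  proof (rule ccontr)
    assume none: "\<not> ?thesis"
    have "\<not> inj_on (e {1..k}) V" if "k \<le> n" for k
      using that
    proof (induction k)
      case 0
      \<comment> \<open>\<open>e {}\<close> is constant, hence injective only if \<open>V\<close> is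
        a single vertex, which the failure of injectivity of \<open>e {1}\<close> excludes.\<close>
      have "1 \<in> {1..n}" using f by (auto simp: taylor_polymorphism_def)
      then have "\<not> inj_on (e {1}) V" using none by blast
      then show ?case by (auto simp: inj_on_def e_def)
    next
      case (Suc k)
      then have "\<not> inj_on (e {1..k}) V" "\<not> inj_on (e {Suc k}) V" using none by auto
      moreover have "{1..k} \<union> {Suc k} = {1..Suc k}" by auto
      ultimately show ?case using union[of "{1..k}" "{Suc k}"] by auto
    qed
    then show False using full by blast
  qed
  then obtain m where m: "m \<in> {1..n}" "inj_on (e {m}) V" by blast
  then obtain a b where ab: "a m = VarX" "b m = VarY"
    and eq: "\<And>x y. x \<in> V \<Longrightarrow> y \<in> V \<Longrightarrow>
        f (\<lambda>i\<in>{1..n}. case a i of VarX \<Rightarrow> x | VarY \<Rightarrow> y) = f (\<lambda>i\<in>{1..n}. case b i of VarX \<Rightarrow> x | VarY \<Rightarrow> y)"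
    using f unfolding taylor_polymorphism_def by blast
  let ?I = "{i. a i = VarX}" and ?J = "{i. b i = VarX}"
  have case_if: "(case s of VarX \<Rightarrow> x | VarY \<Rightarrow> y) = (if s = VarX then x else y)" for s and x y :: 'a
    by (cases s) auto
  have eIJ: "e ?I x = e ?J x" if "x \<in> V" for x
    using eq[OF that x0] by (simp add: case_if e_def)
  have "\<not> inj_on (e ?J) V"
    using disjoint[of "{m}" ?J] m ab by auto
  then have nI: "\<not> inj_on (e ?I) V"
    using eIJ by (simp cong: inj_on_cong)
  \<comment> \<open>The complement of \<open>?I\<close> misses \<open>m\<close> as well, so by
    \<open>union\<close> the injectivity of \<open>e {1..n}\<close> would have to come from
    \<open>?I\<close>, which \<open>nI\<close> excludes.\<close>
  have nI': "\<not> inj_on (e (- ?I)) V"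
    using disjoint[of "{m}" "- ?I"] m ab by auto
  have "e UNIV = e {1..n}"
    unfolding e_def by (intro ext arg_cong[of _ _ f]) auto
  then have "inj_on (e (?I \<union> - ?I)) V" using full by simp
  then show False
    using union[of ?I "- ?I"] nI nI' by blast
qed

section \<open>Induced subcomplexes and walks along edges\<close>

definition induced_subcomplex :: "'a scomplex \<Rightarrow> 'a set \<Rightarrow> 'a scomplex" where
  "induced_subcomplex A B = \<lparr>verts = B, faces = {\<sigma>\<in>faces A. \<sigma> \<subseteq> B}\<rparr>"

lemma verts_induced [simp]: "verts (induced_subcomplex A B) = B"
  and faces_induced: "faces (induced_subcomplex A B) = {\<sigma>\<in>faces A. \<sigma> \<subseteq> B}"
  by (simp_all add: induced_subcomplex_def)

context finite_complex
begin

lemma finite_complex_induced: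
  assumes "B \<subseteq> V" shows "finite_complex (induced_subcomplex A B)"
proof
  show "finite (verts (induced_subcomplex A B))"
    using assms finite_verts by (auto intro: finite_subset)
  show "abstract_simplicial_complex (induced_subcomplex A B)"
    using assms complex by (auto simp: abstract_simplicial_complex_def faces_induced)
qed

lemma simplicial_map_inclusion: "B \<subseteq> V \<Longrightarrow> simplicial_map (induced_subcomplex A B) A (\<lambda>x. x)"
  by (auto simp: simplicial_map_def faces_induced)

text \<open>Applying \<open>r\<close> to both sides keeps the Taylor identities. With
  \<open>r\<close> a retraction this serves the induction, with \<open>r\<close> the identity it
  serves the edge components.\<close>

lemma taylor_induced:
  assumes f: "taylor_polymorphism A n f" and r: "smap r" and B: "B \<subseteq> V"
    and closed: "\<And>t. t \<in> {1..n} \<rightarrow>\<^sub>E B \<Longrightarrow> r (f t) \<in> B"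
  shows "taylor_polymorphism (induced_subcomplex A B) n (\<lambda>t. r (f t))"
proof -
  have "polymorphism (induced_subcomplex A B) n (\<lambda>t. r (f t))"
    unfolding polymorphism_def simplicial_map_def
  proof (intro conjI ballI)
    fix S assume S: "S \<in> faces (power_complex (induced_subcomplex A B) n)"
    then have SB: "S \<subseteq> {1..n} \<rightarrow>\<^sub>E B" by (simp add: power_complex_def)
    have "f ` S \<in> faces A"
    proof (rule polymorphism_face)
      show "polymorphism A n f" using f by (simp add: taylor_polymorphism_def)
      show "S \<subseteq> {1..n} \<rightarrow>\<^sub>E V"
        by (rule order_trans[OF SB PiE_mono]) (rule B)
      show "finite S" "\<And>i. i \<in> {1..n} \<Longrightarrow> (\<lambda>t. t i) ` S \<in> faces A"
        using S by (simp_all add: power_complex_def faces_induced)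
    qed
    then have "r ` f ` S \<in> faces A" using r by (auto simp: simplicial_map_def)
    moreover have "r ` f ` S \<subseteq> B" using SB closed by auto
    ultimately show "(\<lambda>t. r (f t)) ` S \<in> faces (induced_subcomplex A B)"
      by (simp add: faces_induced image_image)
  qed (use closed in \<open>auto simp: power_complex_def\<close>)
  then show ?thesis
    using f B unfolding taylor_polymorphism_def verts_induced by (metis subset_iff)
qed

definition edge_reachable :: "('a \<times> 'a) set" where
  "edge_reachable = {(x, y). {x, y} \<in> faces A}\<^sup>*"

lemma edge_reachable_sym: "(x, y) \<in> edge_reachable \<Longrightarrow> (y, x) \<in> edge_reachable"
  unfolding edge_reachable_def
  by (rule symD[OF sym_rtrancl]) (auto simp: sym_def insert_commute)

lemma edge_reachable_refl: "(x, x) \<in> edge_reachable"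
  by (simp add: edge_reachable_def)

lemma edge_reachable_trans:
  "(x, y) \<in> edge_reachable \<Longrightarrow> (y, z) \<in> edge_reachable \<Longrightarrow> (x, z) \<in> edge_reachable"
  unfolding edge_reachable_def by (rule rtrancl_trans)

lemma edge_reachable_edge: "{x, y} \<in> faces A \<Longrightarrow> (x, y) \<in> edge_reachable"
  by (auto simp: edge_reachable_def)

lemma edge_reachable_in_verts: "(x, y) \<in> edge_reachable \<Longrightarrow> x \<in> V \<Longrightarrow> y \<in> V"
  unfolding edge_reachable_def
  by (induction rule: rtrancl_induct) (use face_verts in auto)

lemma edge_connected_iff: "edge_connected A \<longleftrightarrow> (\<forall>x\<in>V. \<forall>y\<in>V. (x, y) \<in> edge_reachable)"
  by (simp add: edge_connected_def edge_reachable_def)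

lemma edge_reachable_map:
  assumes "\<And>x y. {x, y} \<in> faces A \<Longrightarrow> {h x, h y} \<in> F" "(x, y) \<in> edge_reachable"
  shows "(h x, h y) \<in> {(x, y). {x, y} \<in> F}\<^sup>*"
  using assms(2) unfolding edge_reachable_def
  by (induction rule: rtrancl_induct) (auto intro: rtrancl_into_rtrancl assms(1))

text \<open>Coordinates are changed one at a time. Moving one coordinate along an edge of the
  complex is an edge of the power, which \<open>f\<close> sends to a face.\<close>

lemma polymorphism_edge_reachable:
  assumes f: "polymorphism A n f" and s: "s \<in> {1..n} \<rightarrow>\<^sub>E V"
    and st: "\<And>i. i \<in> {1..n} \<Longrightarrow> (s i, t i) \<in> edge_reachable"
  shows "(f s, f (\<lambda>i\<in>{1..n}. t i)) \<in> edge_reachable"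
proof -
  have coordinate: "(f (u(k := x)), f (u(k := y))) \<in> edge_reachable"
    if u: "u \<in> {1..n} \<rightarrow>\<^sub>E V" and k: "k \<in> {1..n}" and xy: "(x, y) \<in> edge_reachable" for u k x y
    unfolding edge_reachable_def
  proof (rule edge_reachable_map[OF _ xy])
    fix a b assume ab: "{a, b} \<in> faces A"
    have "f ` {u(k := a), u(k := b)} \<in> faces A"
    proof (rule polymorphism_face[OF f])
      show "{u(k := a), u(k := b)} \<subseteq> {1..n} \<rightarrow>\<^sub>E V"
        using u k face_verts[OF ab] by (auto simp: PiE_iff extensional_def)
      fix i assume i: "i \<in> {1..n}"
      then show "(\<lambda>t. t i) ` {u(k := a), u(k := b)} \<in> faces A"
        using u ab by (auto simp: PiE_iff intro: face_single)
    qed simp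
    then show "{f (u(k := a)), f (u(k := b))} \<in> faces A" by simp
  qed
  define p where "p k = (\<lambda>i\<in>{1..n}. if i \<le> k then t i else s i)" for k
  have p: "p k \<in> {1..n} \<rightarrow>\<^sub>E V" for k
    using s st edge_reachable_in_verts by (fastforce simp: p_def PiE_iff)
  have "(f s, f (p k)) \<in> edge_reachable" if "k \<le> n" for k
    using that
  proof (induction k)
    case 0
    have "p 0 = s" using s by (auto simp: p_def PiE_iff intro!: extensionalityI[of _ "{1..n}"])
    then show ?case by (simp add: edge_reachable_refl)
  next
    case (Suc k)
    then have k: "Suc k \<in> {1..n}" by auto
    have "(p k)(Suc k := s (Suc k)) = p k" "(p k)(Suc k := t (Suc k)) = p (Suc k)"
      using k by (auto simp: p_def fun_eq_iff)
    with coordinate[OF p[of k] k st[OF k]] have "(f (p k), f (p (Suc k))) \<in> edge_reachable"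
      by simp
    moreover have "(f s, f (p k)) \<in> edge_reachable" using Suc by simp
    ultimately show ?case by (rule edge_reachable_trans[rotated])
  qed
  moreover have "p n = (\<lambda>i\<in>{1..n}. t i)" by (auto simp: p_def)
  ultimately show ?thesis by (metis order_refl)
qed

end

lemma contractible_if_edge_connected_taylor:
  assumes "finite_complex A" "edge_connected A" "verts A \<noteq> {}"
    and "taylor_polymorphism A n f" "idempotent_op A n f"
  shows "contractible_space (geometric_realization A)"
  using assms
proof (induction "card (verts A)" arbitrary: A f rule: less_induct)
  case less
  interpret finite_complex A by fact
  have "null_retractions A"
  proof (unfold_locales)
    show "edge_connected A" by fact
    fix r assume r: "smap r" and rr: "\<And>x. x \<in> V \<Longrightarrow> r (r x) = r x" and ni: "\<not> inj_on r V"
    let ?B = "r ` V"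
    let ?C = "induced_subcomplex A ?B"
    have BV: "?B \<subseteq> V" using smap_in_verts[OF r] by auto
    have rB: "r x = x" if "x \<in> ?B" for x using that rr by auto
    interpret C: finite_complex ?C by (rule finite_complex_induced[OF BV])
    have "card ?B < card V"
      using ni finite_verts card_image_le[OF finite_verts, of r] eq_card_imp_inj_on[of V r] by fastforce
    moreover have "edge_connected ?C"
      unfolding edge_connected_def verts_induced
    proof (intro ballI)
      fix x y assume xy: "x \<in> ?B" "y \<in> ?B"
      \<comment> \<open>\<open>r\<close> maps a walk in \<open>A\<close> to a walk inside its image
        and fixes the two endpoints.\<close>
      have "(x, y) \<in> edge_reachable"
        using less.prems(2) xy BV unfolding edge_connected_iff by auto
      then have "(r x, r y) \<in> {(x, y). {x, y} \<in> faces ?C}\<^sup>*"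
      proof (rule edge_reachable_map[rotated])
        fix a b assume ab: "{a, b} \<in> faces A"
        then have "r ` {a, b} \<in> faces A" using r unfolding simplicial_map_def by blast
        then show "{r a, r b} \<in> faces ?C"
          using face_verts[OF ab] by (auto simp: faces_induced)
      qed
      then show "(x, y) \<in> {(x, y). {x, y} \<in> faces ?C}\<^sup>*"
        unfolding rB[OF xy(1)] rB[OF xy(2)] .
    qed
    moreover have "taylor_polymorphism ?C n (\<lambda>t. r (f t))"
    proof (rule taylor_induced[OF less.prems(4) r BV])
      fix t assume "t \<in> {1..n} \<rightarrow>\<^sub>E ?B"
      then have "t = restrict t {1..n}" "\<And>i. i \<in> {1..n} \<Longrightarrow> t i \<in> V" using BV by (auto simp: PiE_iff)
      then have "f t \<in> V"
        using polymorphism_in_verts[of n f t] less.prems(4) by (auto simp: taylor_polymorphism_def)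
      then show "r (f t) \<in> ?B" by auto
    qed
    moreover have "idempotent_op ?C n (\<lambda>t. r (f t))"
      unfolding idempotent_op_def verts_induced
    proof
      fix x assume x: "x \<in> ?B"
      then have "f (\<lambda>i\<in>{1..n}. x) = x" using less.prems(5) BV unfolding idempotent_op_def by blast
      then show "r (f (\<lambda>i\<in>{1..n}. x)) = x" using rB[OF x] by simp
    qed
    ultimately have "contractible_space (geometric_realization ?C)"
      using less.prems(3) by (intro less.hyps C.finite_complex_self) auto
    moreover have rC: "simplicial_map A ?C r"
      using r by (auto simp: simplicial_map_def faces_induced dest: face_verts)
    have "realize A A r = realize ?C A (\<lambda>x. x) \<circ> realize A ?C r"
      using realize_compose[OF finite_complex_self C.finite_complex_self, of r A "\<lambda>x. x"]
      by (auto simp: fun_eq_iff o_def)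
    ultimately show "nullmap r"
      using nullhomotopic_through_contractible_space[of X "geometric_realization ?C" "realize A ?C r" X "realize ?C A (\<lambda>x. x)"]
        continuous_map_realize[OF finite_complex_self C.finite_complex_self rC]
        continuous_map_realize[OF C.finite_complex_self finite_complex_self simplicial_map_inclusion[OF BV]]
      by metis
  qed
  then show ?case
    using null_retractions.contractible_if_taylor less.prems by blast
qed

section \<open>Connected components of the realization\<close>

context finite_complex
begin

definition reachable_points :: "'a \<Rightarrow> ('a \<Rightarrow> real) set" where
  "reachable_points v = {t\<in>topspace X. support A t \<subseteq> edge_reachable `` {v}}"

text \<open>Any two vertices of the support span an edge, so one reachable vertex makes all of them
  reachable.\<close>

lemma support_reachable:
  assumes "t \<in> topspace X" "w \<in> support A t" "(v, w) \<in> edge_reachable"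
  shows "t \<in> reachable_points v"
proof -
  have "(v, z) \<in> edge_reachable" if "z \<in> support A t" for z
  proof -
    have "{w, z} \<in> faces A"
      by (rule face_subset[of "support A t"]) (use assms that in \<open>auto simp: topspace_realization\<close>)
    then show ?thesis
      using assms(3) edge_reachable_edge edge_reachable_trans by blast
  qed
  then show ?thesis using assms(1) by (auto simp: reachable_points_def)
qed

text \<open>The total weight on the edge component of \<open>v\<close> is continuous and takes only
  the values \<open>0\<close> and \<open>1\<close>, so the set is the preimage of an open and of a
  closed half-line.\<close>

lemma clopen_reachable_points:
  assumes v: "v \<in> V"
  shows "openin X (reachable_points v)" "closedin X (reachable_points v)"
proof -
  define W where "W = edge_reachable `` {v}"
  have WV: "W \<subseteq> V" using edge_reachable_in_verts v by (auto simp: W_def)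
  define \<phi> where "\<phi> t = sum t W" for t :: "'a \<Rightarrow> real"
  have \<phi>: "continuous_map X euclideanreal \<phi>"
    unfolding \<phi>_def using WV finite_verts
    by (intro continuous_map_sum continuous_map_coordinate) (auto intro: finite_subset)
  have inside: "\<phi> t = 1" if "t \<in> reachable_points v" for t
  proof -
    have "sum t W = sum t V"
      using that WV finite_verts
      by (intro sum.mono_neutral_left) (auto simp: reachable_points_def support_def W_def)
    then show ?thesis using that by (simp add: \<phi>_def reachable_points_def topspace_realization)
  qed
  have outside: "\<phi> t = 0" if "t \<in> topspace X" "t \<notin> reachable_points v" for t
    unfolding \<phi>_def
  proof (rule sum.neutral, rule ballI)
    fix w assume "w \<in> W"
    then have "w \<notin> support A t"
      using support_reachable[OF that(1)] that(2) by (auto simp: W_def)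
    then show "t w = 0" using \<open>w \<in> W\<close> WV by (auto simp: support_def)
  qed
  have sub: "reachable_points v \<subseteq> topspace X" by (auto simp: reachable_points_def)
  have eq: "{t \<in> topspace X. \<phi> t \<in> {1/2<..}} = reachable_points v"
    "{t \<in> topspace X. \<phi> t \<in> {1/2..}} = reachable_points v"
    using inside outside sub by force+
  show "openin X (reachable_points v)"
    using openin_continuous_map_preimage[OF \<phi>, of "{1/2<..}"] eq(1) by simp
  show "closedin X (reachable_points v)"
    using closedin_continuous_map_preimage[OF \<phi>, of "{1/2..}"] eq(2) by simp
qed

lemma contractible_reachable_points:
  assumes f: "taylor_polymorphism A n f" and idem: "idempotent_op A n f" and v: "v \<in> V"
  shows "contractible_space (subtopology X (reachable_points v))"
proof -
  define W where "W = edge_reachable `` {v}"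
  have WV: "W \<subseteq> V" using edge_reachable_in_verts v by (auto simp: W_def)
  have vW: "v \<in> W" by (simp add: W_def edge_reachable_refl)
  let ?C = "induced_subcomplex A W" and ?R = "subtopology X (reachable_points v)"
  interpret C: finite_complex ?C by (rule finite_complex_induced[OF WV])
  \<comment> \<open>Idempotence gives \<open>f (v, ..., v) = v\<close>, and every tuple over
    \<open>W\<close> can be walked to that constant tuple.\<close>
  have closed: "f t \<in> W" if t: "t \<in> {1..n} \<rightarrow>\<^sub>E W" for t
  proof -
    have "t \<in> {1..n} \<rightarrow>\<^sub>E V"
      by (rule subsetD[OF PiE_mono t]) (rule WV)
    then have "(f t, f (\<lambda>i\<in>{1..n}. v)) \<in> edge_reachable"
      using f t edge_reachable_sym by (intro polymorphism_edge_reachable)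
        (auto simp: taylor_polymorphism_def W_def PiE_iff)
    then have "(f t, v) \<in> edge_reachable"
      using idem v by (simp add: idempotent_op_def)
    then show ?thesis using edge_reachable_sym by (auto simp: W_def)
  qed
  have "edge_connected ?C"
    unfolding edge_connected_def verts_induced
  proof (intro ballI)
    fix x y assume xy: "x \<in> W" "y \<in> W"
    then have "(v, x) \<in> edge_reachable" "(v, y) \<in> edge_reachable" by (simp_all add: W_def)
    then have "(x, y) \<in> edge_reachable"
      using edge_reachable_trans[OF edge_reachable_sym] by blast
    then show "(x, y) \<in> {(x, y). {x, y} \<in> faces ?C}\<^sup>*"
      unfolding edge_reachable_def
    proof (induction rule: rtrancl_induct)
      case (step y z)
      then have yz: "{y, z} \<in> faces A" by simp
      have "(v, x) \<in> edge_reachable" "(x, y) \<in> edge_reachable"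
        using xy step.hyps by (auto simp: W_def edge_reachable_def)
      then have vy: "(v, y) \<in> edge_reachable" by (rule edge_reachable_trans)
      then have "(v, z) \<in> edge_reachable"
        using edge_reachable_edge[OF yz] by (rule edge_reachable_trans)
      with vy have "y \<in> W" "z \<in> W" by (simp_all add: W_def)
      with yz have "(y, z) \<in> {(x, y). {x, y} \<in> faces ?C}" by (simp add: faces_induced)
      with step.IH show ?case by (rule rtrancl_into_rtrancl)
    qed simp
  qed
  then have con: "contractible_space (geometric_realization ?C)"
    using taylor_induced[OF f smap_id WV closed] idem vW WV
    by (intro contractible_if_edge_connected_taylor[OF C.finite_complex_self, of n f])
      (auto simp: idempotent_op_def)
  note incl = simplicial_map_inclusion[OF WV]
  \<comment> \<open>The map extends a point by zero outside \<open>W\<close>, with restriction to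
    \<open>W\<close> as right inverse; a one-sided inverse already transfers
    contractibility.\<close>
  have "retraction_map (geometric_realization ?C) ?R (realize ?C A (\<lambda>x. x))"
    unfolding retraction_map_def retraction_maps_def
  proof (intro exI[of _ "\<lambda>t. restrict t W"] conjI ballI)
    have "realize ?C A (\<lambda>x. x) t \<in> reachable_points v" if "t \<in> topspace (geometric_realization ?C)" for t
      using realize_in_realization[OF C.finite_complex_self finite_complex_self incl that]
        support_realize[OF C.finite_complex_self incl that]
      by (auto simp: reachable_points_def W_def support_def)
    then show "continuous_map (geometric_realization ?C) ?R (realize ?C A (\<lambda>x. x))"
      using continuous_map_realize[OF C.finite_complex_self finite_complex_self incl]
      by (intro continuous_map_into_subtopology) auto
  next
    show "continuous_map ?R (geometric_realization ?C) (\<lambda>t. restrict t W)"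
      unfolding C.continuous_map_realization
    proof (intro conjI ballI)
      fix t assume "t \<in> topspace ?R"
      then have t: "t \<in> topspace X" "support A t \<subseteq> W"
        by (auto simp: reachable_points_def W_def)
      have "support ?C (restrict t W) = support A t" using t WV by (auto simp: support_def)
      moreover have "sum t W = sum t V"
        using t(2) WV finite_verts by (intro sum.mono_neutral_left) (auto simp: support_def)
      ultimately show "restrict t W \<in> topspace (geometric_realization ?C)"
        using t WV by (auto simp: C.topspace_realization topspace_realization faces_induced)
    next
      fix w assume "w \<in> verts ?C"
      then show "continuous_map ?R euclideanreal (\<lambda>t. restrict t W w)"
        using WV by (auto intro!: continuous_map_from_subtopology continuous_map_coordinate)
    qed
  next
    fix t assume "t \<in> topspace ?R"
    then have t: "t \<in> topspace X" "support A t \<subseteq> W"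
      by (auto simp: reachable_points_def W_def)
    show "realize ?C A (\<lambda>x. x) (restrict t W) = t"
    proof (rule point_ext)
      fix w assume w: "w \<in> V"
      have "{i \<in> W. i = w} = (if w \<in> W then {w} else {})" by auto
      then show "realize ?C A (\<lambda>x. x) (restrict t W) w = t w"
        using w t(2) by (auto simp: realize_def pushforward_def support_def)
    qed (use t in \<open>auto simp: realize_def pushforward_def topspace_realization\<close>)
  qed
  with con show ?thesis by (rule contractible_space_retraction_map_image[rotated])
qed

end

theorem theorem5p17:
  fixes A :: "'a scomplex" and n :: nat and f :: "(nat \<Rightarrow> 'a) \<Rightarrow> 'a"
  assumes "abstract_simplicial_complex A"
    and "finite (verts A)"
    and "taylor_polymorphism A n f"
    and "idempotent_op A n f"
  shows "\<forall>C\<in>connected_components_of (geometric_realization A).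
           contractible_space (subtopology (geometric_realization A) C)"
proof
  fix C assume C: "C \<in> connected_components_of (geometric_realization A)"
  interpret finite_complex A by unfold_locales fact+
  obtain t where t: "t \<in> C" using nonempty_connected_components_of[OF C] by auto
  then have tX: "t \<in> topspace X" using connected_components_of_subset[OF C] by auto
  obtain v where v: "v \<in> V" "v \<in> support A t" using support_nonempty[OF tX] .
  let ?R = "reachable_points v"
  have tR: "t \<in> ?R" using support_reachable[OF tX v(2) edge_reachable_refl] .
  have con: "contractible_space (subtopology X ?R)"
    using contractible_reachable_points assms(3,4) v(1) by blast
  then have "connectedin X ?R"
    using contractible_imp_connected_space
    by (auto simp: connectedin_def reachable_points_def)
  \<comment> \<open>A connected clopen set is the component of each of its points.\<close>
  then have "?R \<subseteq> C"
    using connected_components_of_maximal[OF C] t tR by (auto simp: disjnt_iff)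
  moreover have "C \<subseteq> ?R"
    using connectedin_clopen_cases[OF connectedin_connected_components_of[OF C]
        clopen_reachable_points(2)[OF v(1)] clopen_reachable_points(1)[OF v(1)]] t tR
    by (auto simp: disjnt_iff)
  ultimately show "contractible_space (subtopology (geometric_realization A) C)"
    using con by simp
qed

end
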